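(* Let $1\le W\le N/3$, $\zeta>1$, $p\ge1$, $\bar\theta>0$, and $L_N$ with $4\bar\theta\le L_N\le(2N+1)\bar\theta$. For any online algorithm $\mathcal A$ there exists an LQ tracking problem of the form $\frac12\sum_{t=0}^{N-1}\big[(x_t-\theta_t)^\top Q(x_t-\theta_t)+u_t^\top Ru_t\big]+\frac12x_N^\top P^ex_N$ (with $Q>0,R>0$, $P^e$ the positive definite solution of the DARE $P^e=Q+A^\top(P^e-P^eB(B^\top P^eB+R)^{-1}B^\top P^e)A$, $x_0=0$, $\|\theta_t\|\le\bar\theta$) such that (i) $(A,B)$ is in canonical form with controllability index $p$; (ii) $\sum_{t=0}^N\|\theta_t-\theta_{t-1}\|\le L_N$ (with $\theta_{-1}=0$, $\theta_N=0$); (iii) the associated $C(\mathbf z)$ has condition number $\zeta$; and $$\mathrm{Regret}(\mathcal A)\ge c\Big(\frac{\sqrt\zeta-1}{\sqrt\zeta+1}\Big)^{2K}L_N\ \ge c\Big(\frac{\sqrt\zeta-1}{\sqrt\zeta+1}\Big)^{2K}\sum_{t=0}^N\|\theta_t-\theta_{t-1}\|,$$ where $K=\lfloor(W-1)/p\rfloor$ and $c>0$ is a constant independent of $N$, $W$ and $L_N$.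
   Context: Canonical form: indices $0=k_0<k_1<\dots<k_m=n$, $\mathcal I=\{k_1,\dots,k_m\}$; rows $i\notin\mathcal I$ of $A$ equal $e_{i+1}^\top$, rows in $\mathcal I$ arbitrary; $j$-th column of $B$ is $e_{k_j}$; controllability index $p=\max_i(k_i-k_{i-1})$. An online algorithm with lookahead $W$ is a map $u_t=\mathcal A(x_t,\dots,x_0,\{f_s,g_s\}_{s=0}^{t+W-1})$, where here $f_s(x)=\frac12(x-\theta_s)^\top Q(x-\theta_s)$, $g_s(u)=\frac12u^\top Ru$; $\mathrm{Regret}(\mathcal A)=J(\mathcal A)-J^*$ with $J^*$ the offline optimal cost. $C(\mathbf z)$ is the cost in the variables $z_t=x_t^{\mathcal I}$: $C(\mathbf z)=J(\mathbf x(\mathbf z),\mathbf u(\mathbf z))$ with $x_t(\mathbf z)=(z^1_{t-p_1+1},\dots,z^1_t,\dots,z^m_{t-p_m+1},\dots,z^m_t)^\top$, $u_t(\mathbf z)=z_{t+1}-A(\mathcal I,:)x_t(\mathbf z)$, $z_t=0$ for $t\le0$; it is a quadratic, and its condition number is the ratio of the largest to smallest eigenvalue of its Hessian. *)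

theory Defs
  imports Complex_Main "Jordan_Normal_Form.Matrix" "Jordan_Normal_Form.Char_Poly"
begin

(* Vectors/matrices are Jordan_Normal_Form vec/mat; indices are 0-based.
   Paper index i (1-based) corresponds to Isabelle index i-1. *)

definition vnorm :: "real vec \<Rightarrow> real" where
  "vnorm v = sqrt (v \<bullet> v)"

definition posdef :: "nat \<Rightarrow> real mat \<Rightarrow> bool" where
  "posdef n M \<longleftrightarrow> M \<in> carrier_mat n n \<and> transpose_mat M = M \<and>
     (\<forall>v \<in> carrier_vec n. v \<noteq> 0\<^sub>v n \<longrightarrow> v \<bullet> (M *\<^sub>v v) > 0)"

(* Canonical form with indices 0 = k_0 < k_1 < ... < k_m = n and controllability index p.
   Paper row i (1-based) = Isabelle row r = i-1; I = {k_1,...,k_m}.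
   Rows i \<notin> I of A equal e_{i+1}^T; j-th column of B is e_{k_j}. *)
definition canonical_form :: "nat \<Rightarrow> nat \<Rightarrow> real mat \<Rightarrow> real mat \<Rightarrow> (nat \<Rightarrow> nat) \<Rightarrow> nat \<Rightarrow> bool" where
  "canonical_form n m A B k p \<longleftrightarrow>
     1 \<le> m \<and> A \<in> carrier_mat n n \<and> B \<in> carrier_mat n m \<and>
     k 0 = 0 \<and> k m = n \<and> (\<forall>i<m. k i < k (Suc i)) \<and>
     (\<forall>r<n. Suc r \<notin> k ` {1..m} \<longrightarrow> (\<forall>c<n. A $$ (r, c) = (if c = Suc r then 1 else 0))) \<and>
     (\<forall>r<n. \<forall>j<m. B $$ (r, j) = (if Suc r = k (Suc j) then 1 else 0)) \<and>
     p = Max ((\<lambda>i. k i - k (i - 1)) ` {1..m})"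

definition dare_solution :: "nat \<Rightarrow> nat \<Rightarrow> real mat \<Rightarrow> real mat \<Rightarrow> real mat \<Rightarrow> real mat \<Rightarrow> real mat \<Rightarrow> bool" where
  "dare_solution n m A B Q R P \<longleftrightarrow> posdef n P \<and>
     (\<exists>Minv \<in> carrier_mat m m.
        Minv * (transpose_mat B * P * B + R) = 1\<^sub>m m \<and>
        (transpose_mat B * P * B + R) * Minv = 1\<^sub>m m \<and>
        P = Q + transpose_mat A * (P - P * B * Minv * transpose_mat B * P) * A)"

definition lq_cost :: "nat \<Rightarrow> real mat \<Rightarrow> real mat \<Rightarrow> real mat \<Rightarrow> (nat \<Rightarrow> real vec)
    \<Rightarrow> (nat \<Rightarrow> real vec) \<Rightarrow> (nat \<Rightarrow> real vec) \<Rightarrow> real" where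
  "lq_cost N Q R P \<theta> x u =
     (1/2) * (\<Sum>t<N. (x t - \<theta> t) \<bullet> (Q *\<^sub>v (x t - \<theta> t)) + u t \<bullet> (R *\<^sub>v u t))
     + (1/2) * (x N \<bullet> (P *\<^sub>v x N))"

fun states :: "real mat \<Rightarrow> real mat \<Rightarrow> (nat \<Rightarrow> real vec) \<Rightarrow> nat \<Rightarrow> real vec" where
  "states A B u 0 = 0\<^sub>v (dim_row A)"
| "states A B u (Suc t) = A *\<^sub>v states A B u t + B *\<^sub>v u t"

definition J :: "nat \<Rightarrow> real mat \<Rightarrow> real mat \<Rightarrow> real mat \<Rightarrow> real mat \<Rightarrow> real mat
    \<Rightarrow> (nat \<Rightarrow> real vec) \<Rightarrow> (nat \<Rightarrow> real vec) \<Rightarrow> real" where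
  "J N A B Q R P \<theta> u = lq_cost N Q R P \<theta> (states A B u) u"

definition J_opt :: "nat \<Rightarrow> nat \<Rightarrow> real mat \<Rightarrow> real mat \<Rightarrow> real mat \<Rightarrow> real mat \<Rightarrow> real mat
    \<Rightarrow> (nat \<Rightarrow> real vec) \<Rightarrow> real" where
  "J_opt N m A B Q R P \<theta> = Inf {J N A B Q R P \<theta> u | u. \<forall>t. u t \<in> carrier_vec m}"

(* An online algorithm: u_t = alg t (x_0..x_t) (f_0, f_1, ...) (g_0, g_1, ...),
   where the output may only depend on x_s (s \<le> t) and f_s, g_s (s \<le> t + W - 1). *)
type_synonym online_alg =
  "nat \<Rightarrow> (nat \<Rightarrow> real vec) \<Rightarrow> (nat \<Rightarrow> real vec \<Rightarrow> real) \<Rightarrow> (nat \<Rightarrow> real vec \<Rightarrow> real) \<Rightarrow> real vec"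

definition online :: "nat \<Rightarrow> online_alg \<Rightarrow> bool" where
  "online W alg \<longleftrightarrow> (\<forall>t xs xs' fs fs' gs gs'.
      (\<forall>s\<le>t. xs s = xs' s) \<and> (\<forall>s<t + W. fs s = fs' s \<and> gs s = gs' s)
      \<longrightarrow> alg t xs fs gs = alg t xs' fs' gs')"

definition as_input :: "nat \<Rightarrow> real vec \<Rightarrow> real vec" where
  "as_input m v = vec m (\<lambda>j. if j < dim_vec v then v $ j else 0)"

definition f_stage :: "nat \<Rightarrow> nat \<Rightarrow> real mat \<Rightarrow> (nat \<Rightarrow> real vec) \<Rightarrow> nat \<Rightarrow> real vec \<Rightarrow> real" where
  "f_stage N n Q \<theta> s x = (let th = (if s < N then \<theta> s else 0\<^sub>v n) in (1/2) * ((x - th) \<bullet> (Q *\<^sub>v (x - th))))"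

definition g_stage :: "real mat \<Rightarrow> nat \<Rightarrow> real vec \<Rightarrow> real" where
  "g_stage R s u = (1/2) * (u \<bullet> (R *\<^sub>v u))"

fun alg_hist :: "nat \<Rightarrow> real mat \<Rightarrow> real mat \<Rightarrow> online_alg \<Rightarrow> (nat \<Rightarrow> real vec \<Rightarrow> real)
    \<Rightarrow> (nat \<Rightarrow> real vec \<Rightarrow> real) \<Rightarrow> nat \<Rightarrow> real vec list" where
  "alg_hist m A B alg fs gs 0 = [0\<^sub>v (dim_row A)]"
| "alg_hist m A B alg fs gs (Suc t) =
     (let h = alg_hist m A B alg fs gs t;
          u = as_input m (alg t (\<lambda>s. if s < length h then h ! s else 0\<^sub>v (dim_row A)) fs gs)
      in h @ [A *\<^sub>v last h + B *\<^sub>v u])"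

definition alg_input :: "nat \<Rightarrow> real mat \<Rightarrow> real mat \<Rightarrow> online_alg \<Rightarrow> (nat \<Rightarrow> real vec \<Rightarrow> real)
    \<Rightarrow> (nat \<Rightarrow> real vec \<Rightarrow> real) \<Rightarrow> nat \<Rightarrow> real vec" where
  "alg_input m A B alg fs gs t =
     (let h = alg_hist m A B alg fs gs t
      in as_input m (alg t (\<lambda>s. if s < length h then h ! s else 0\<^sub>v (dim_row A)) fs gs))"

definition regret :: "nat \<Rightarrow> nat \<Rightarrow> nat \<Rightarrow> real mat \<Rightarrow> real mat \<Rightarrow> real mat \<Rightarrow> real mat \<Rightarrow> real mat
    \<Rightarrow> (nat \<Rightarrow> real vec) \<Rightarrow> online_alg \<Rightarrow> real" where
  "regret N n m A B Q R P \<theta> alg =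
     J N A B Q R P \<theta> (alg_input m A B alg (f_stage N n Q \<theta>) (g_stage R))
     - J_opt N m A B Q R P \<theta>"

definition path_length :: "nat \<Rightarrow> nat \<Rightarrow> (nat \<Rightarrow> real vec) \<Rightarrow> real" where
  "path_length N n \<theta> =
     (let th = (\<lambda>t. if t < N then \<theta> t else 0\<^sub>v n)
      in vnorm (th 0) + (\<Sum>t\<in>{1..N}. vnorm (th t - th (t - 1))))"

(* C(z): z = (z_1,...,z_N), z_t \<in> R^m, stored as a vector of length N*m, z_t^j (1-based j)
   at position (t-1)*m + (j-1); z_t = 0 for t \<le> 0. *)
definition z_comp :: "nat \<Rightarrow> real vec \<Rightarrow> int \<Rightarrow> nat \<Rightarrow> real" where
  "z_comp m z t j = (if t \<ge> 1 then z $ (nat (t - 1) * m + j) else 0)"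

(* x_t(z): state component r (0-based) in block i (k_{i-1} \<le> r < k_i) equals
   z^i_{t - p_i + 1 + (r - k_{i-1})} = z^i_{t + r + 1 - k_i} *)
definition x_of_z :: "nat \<Rightarrow> nat \<Rightarrow> (nat \<Rightarrow> nat) \<Rightarrow> real vec \<Rightarrow> nat \<Rightarrow> real vec" where
  "x_of_z n m k z t = vec n (\<lambda>r. let i = (LEAST i. r < k i) in
      z_comp m z (int t + int r + 1 - int (k i)) (i - 1))"

definition u_of_z :: "nat \<Rightarrow> nat \<Rightarrow> (nat \<Rightarrow> nat) \<Rightarrow> real mat \<Rightarrow> real vec \<Rightarrow> nat \<Rightarrow> real vec" where
  "u_of_z n m k A z t = vec m (\<lambda>j. z_comp m z (int t + 1) j
      - row A (k (Suc j) - 1) \<bullet> x_of_z n m k z t)"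

definition C_cost :: "nat \<Rightarrow> nat \<Rightarrow> nat \<Rightarrow> (nat \<Rightarrow> nat) \<Rightarrow> real mat \<Rightarrow> real mat \<Rightarrow> real mat \<Rightarrow> real mat
    \<Rightarrow> (nat \<Rightarrow> real vec) \<Rightarrow> real vec \<Rightarrow> real" where
  "C_cost N n m k A Q R P \<theta> z = lq_cost N Q R P \<theta> (x_of_z n m k z) (u_of_z n m k A z)"

definition rderiv :: "(real \<Rightarrow> real) \<Rightarrow> real \<Rightarrow> real" where
  "rderiv f x = (SOME D. (f has_real_derivative D) (at x))"

definition hessian :: "nat \<Rightarrow> (real vec \<Rightarrow> real) \<Rightarrow> real vec \<Rightarrow> real mat" where
  "hessian d f z = mat d d (\<lambda>(i, j).
      rderiv (\<lambda>s. rderiv (\<lambda>r. f (z + r \<cdot>\<^sub>v unit_vec d i + s \<cdot>\<^sub>v unit_vec d j)) 0) 0)"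

definition condition_number :: "real mat \<Rightarrow> real" where
  "condition_number H = Max {l. eigenvalue H l} / Min {l. eigenvalue H l}"

end

theory Submission
  imports Defs
begin

text \<open>
  The hard instance is a cyclic shift of length \<open>p\<close>: with \<open>z\<close> the last coordinate of its state, the input
  is \<open>z\<^sub>s - z\<^bsub>s-p\<^esub>\<close>. For a diagonal \<open>Q\<close> the DARE solution is diagonal and the cost, DARE terminal cost
  included, is \<open>\<Sum>\<^sub>s (z\<^sub>s - \<rho> z\<^bsub>s-p\<^esub> - \<rho> q H\<^sub>s)\<^sup>2 / (2\<rho>)\<close> plus a constant, where \<open>H\<^sub>s\<close> discounts by \<open>\<rho>\<close> the targets at
  \<open>s, s + p, s + 2p, \<dots>\<close>. So the regret is at least this sum of squares, and a target that is still unseen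
  enters it with weight \<open>\<rho>\<^sup>K\<close>.

  The Hessian of this cost has its spectrum in \<open>[(1 - \<rho>)\<^sup>2 / \<rho>, (1 + \<rho>)\<^sup>2 / \<rho>]\<close>, whose endpoints have ratio \<open>\<zeta>\<close>, but
  at a finite horizon the endpoints are not attained. Two decoupled scalar blocks, whose Hessians are
  the multiples of the identity by the two endpoints, make the condition number exactly \<open>\<zeta>\<close>.

  The adversary places \<open>M\<close> spikes \<open>\<plusminus>\<theta>\<close>. Flipping one spike leaves the input chosen just before its
  revelation unchanged but moves the optimal input, so the two squares cannot both be small; averaging
  over all sign patterns yields a pattern with regret of order \<open>M\<close>.
\<close>

section \<open>Quadratic forms, sign averaging and causality\<close>

lemma rderiv_eqI: "(f has_real_derivative D) (at x) \<Longrightarrow> rderiv f x = D"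
  unfolding rderiv_def using DERIV_unique by (blast intro: some_equality)

text \<open>Along two coordinate directions \<open>f\<close> is a polynomial, and the second
  derivative removes \<open>c\<close> and \<open>\<beta> k\<close>. The Hessian is therefore
  independent of the targets.\<close>

lemma hessian_sum_squares:
  assumes L: "\<And>k. k < e \<Longrightarrow> L k \<in> carrier_vec d"
    and f: "\<And>z. z \<in> carrier_vec d \<Longrightarrow> f z = c + (1/2) * (\<Sum>k<e. w k * (L k \<bullet> z - \<beta> k)\<^sup>2)"
  shows "hessian d f (0\<^sub>v d) = mat d d (\<lambda>(i, j). \<Sum>k<e. w k * L k $ i * L k $ j)"
proof (rule eq_matI)
  fix i j
  assume "i < dim_row (mat d d (\<lambda>(i, j). \<Sum>k<e. w k * L k $ i * L k $ j))"
    and "j < dim_col (mat d d (\<lambda>(i, j). \<Sum>k<e. w k * L k $ i * L k $ j))"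
  then have i: "i < d" and j: "j < d" by auto
  have f': "f (0\<^sub>v d + r \<cdot>\<^sub>v unit_vec d i + s \<cdot>\<^sub>v unit_vec d j)
      = c + (1/2) * (\<Sum>k<e. w k * (r * L k $ i + s * L k $ j - \<beta> k)\<^sup>2)" for r s
  proof -
    have "L k \<bullet> (0\<^sub>v d + r \<cdot>\<^sub>v unit_vec d i + s \<cdot>\<^sub>v unit_vec d j) = r * L k $ i + s * L k $ j"
      if "k < e" for k
      using L[OF that] i j by (simp add: scalar_prod_add_distrib[of _ d])
    then show ?thesis by (subst f) auto
  qed
  have 1: "rderiv (\<lambda>r. f (0\<^sub>v d + r \<cdot>\<^sub>v unit_vec d i + s \<cdot>\<^sub>v unit_vec d j)) 0
      = (\<Sum>k<e. w k * L k $ i * (s * L k $ j - \<beta> k))" for s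
    unfolding f'
    by (rule rderiv_eqI) (auto intro!: derivative_eq_intros sum.cong simp: sum_distrib_left field_simps)
  have "rderiv (\<lambda>s. rderiv (\<lambda>r. f (0\<^sub>v d + r \<cdot>\<^sub>v unit_vec d i + s \<cdot>\<^sub>v unit_vec d j)) 0) 0
      = (\<Sum>k<e. w k * L k $ i * L k $ j)"
    unfolding 1
    by (rule rderiv_eqI) (auto intro!: derivative_eq_intros sum.cong simp: field_simps)
  then show "hessian d f (0\<^sub>v d) $$ (i, j) = mat d d (\<lambda>(i, j). \<Sum>k<e. w k * L k $ i * L k $ j) $$ (i, j)"
    using i j by (simp add: hessian_def)
qed (simp_all add: hessian_def)

lemma finite_eigenvalues:
  fixes H :: "real mat"
  assumes "H \<in> carrier_mat d d"
  shows "finite {l. eigenvalue H l}"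
  unfolding eigenvalue_root_char_poly[OF assms]
  by (rule poly_roots_finite) (use degree_monic_char_poly[OF assms] in auto)

text \<open>An eigenvector turns the bounds on the quadratic form into bounds on its eigenvalue, and
  both bounds are attained. Finiteness of the spectrum gives \<open>Max\<close> and
  \<open>Min\<close> their meaning.\<close>

lemma condition_number_eqI:
  assumes H: "H \<in> carrier_mat d d" and "eigenvalue H lo" "eigenvalue H hi"
    and bnd: "\<And>v. v \<in> carrier_vec d \<Longrightarrow> lo * (v \<bullet> v) \<le> v \<bullet> (H *\<^sub>v v) \<and> v \<bullet> (H *\<^sub>v v) \<le> hi * (v \<bullet> v)"
  shows "condition_number H = hi / lo"
proof -
  have range: "lo \<le> l \<and> l \<le> hi" if ev: "eigenvalue H l" for l
  proof -
    obtain v where v: "v \<in> carrier_vec d" "v \<noteq> 0\<^sub>v d" "H *\<^sub>v v = l \<cdot>\<^sub>v v"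
      using ev H by (auto simp: eigenvalue_def eigenvector_def)
    have pos: "v \<bullet> v > 0" using conjugate_square_greater_0_vec[OF v(1)] v(2) by simp
    show ?thesis using bnd[OF v(1)] v(1) pos unfolding v(3) by simp
  qed
  show ?thesis
    unfolding condition_number_def
    using assms(2,3) range finite_eigenvalues[OF H]
    by (intro arg_cong2[where f="(/)"] Max_eqI Min_eqI) auto
qed

lemma sum_squares_quadratic_form:
  fixes w :: "nat \<Rightarrow> real"
  assumes L: "\<And>k. k < e \<Longrightarrow> L k \<in> carrier_vec d" and v: "v \<in> carrier_vec d"
  shows "v \<bullet> (mat d d (\<lambda>(i, j). \<Sum>k<e. w k * L k $ i * L k $ j) *\<^sub>v v) = (\<Sum>k<e. w k * (L k \<bullet> v)\<^sup>2)"
proof -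
  have "v \<bullet> (mat d d (\<lambda>(i, j). \<Sum>k<e. w k * L k $ i * L k $ j) *\<^sub>v v)
      = (\<Sum>i<d. \<Sum>j<d. \<Sum>k<e. w k * (L k $ i * v $ i) * (L k $ j * v $ j))"
    using v by (auto simp: scalar_prod_def atLeast0LessThan sum_distrib_left sum_distrib_right
        intro!: sum.cong simp: mult_ac)
  also have "\<dots> = (\<Sum>k<e. \<Sum>i<d. \<Sum>j<d. w k * (L k $ i * v $ i) * (L k $ j * v $ j))"
    by (subst (2) sum.swap, subst sum.swap) (rule refl)
  also have "\<dots> = (\<Sum>k<e. w k * (L k \<bullet> v)\<^sup>2)"
    using v by (auto simp: scalar_prod_def atLeast0LessThan power2_eq_square sum_product
        sum_distrib_left mult_ac intro!: sum.cong)
  finally show ?thesis .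
qed

section \<open>Diagonal matrices\<close>

lemma mat_diag_mult_vec_index:
  "v \<in> carrier_vec d \<Longrightarrow> i < d \<Longrightarrow> (mat_diag d f *\<^sub>v v) $ i = f i * (v $ i :: real)"
  by (auto simp: mat_diag_def scalar_prod_def if_distrib if_distribR cong: if_cong)

lemma mat_diag_quadratic_form:
  fixes v :: "real vec"
  assumes "v \<in> carrier_vec d"
  shows "v \<bullet> (mat_diag d f *\<^sub>v v) = (\<Sum>i<d. f i * (v $ i)\<^sup>2)"
proof -
  have "dim_vec (mat_diag d f *\<^sub>v v) = d" by (simp add: mat_diag_def)
  then show ?thesis
    unfolding scalar_prod_def using assms
    by (auto simp: mat_diag_mult_vec_index power2_eq_square atLeast0LessThan mult_ac
        simp del: index_mult_mat_vec intro!: sum.cong)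
qed

lemma mat_diag_add: "mat_diag d f + mat_diag d g = mat_diag d (\<lambda>i. f i + g i :: real)"
  and mat_diag_minus: "mat_diag d f - mat_diag d g = mat_diag d (\<lambda>i. f i - g i :: real)"
  by (rule eq_matI; auto simp: mat_diag_def)+

lemma mat_diag_cong: "(\<And>i. i < d \<Longrightarrow> f i = g i) \<Longrightarrow> mat_diag d f = mat_diag d g"
  by (rule eq_matI) (auto simp: mat_diag_def)

lemma posdef_mat_diag:
  assumes "\<And>i. i < d \<Longrightarrow> f i > 0"
  shows "posdef d (mat_diag d f)"
proof -
  have "0 < v \<bullet> (mat_diag d f *\<^sub>v v)" if v: "v \<in> carrier_vec d" "v \<noteq> 0\<^sub>v d" for v
  proof -
    obtain i where i: "i < d" "v $ i \<noteq> 0" using v by (metis carrier_vecD eq_vecI index_zero_vec)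
    have "0 < f i * (v $ i)\<^sup>2" using i assms by simp
    also have "\<dots> \<le> (\<Sum>i<d. f i * (v $ i)\<^sup>2)"
      using i assms by (intro member_le_sum) (simp_all add: less_imp_le)
    finally show ?thesis by (simp add: mat_diag_quadratic_form[OF v(1)])
  qed
  moreover have "transpose_mat (mat_diag d f) = mat_diag d f"
    by (auto simp: mat_diag_def)
  ultimately show ?thesis by (simp add: posdef_def)
qed

text \<open>\<open>J_opt\<close> ranges over input sequences, whereas the optimal input is a
  feedback law. Unrolling the closed loop turns the law into a sequence.\<close>

lemma feedback_realizable:
  "\<exists>u. \<forall>t. u t = fb t (states A B u t)"
proof -
  define x where "x = rec_nat (0\<^sub>v (dim_row A)) (\<lambda>t y. A *\<^sub>v y + B *\<^sub>v fb t y)"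
  have "states A B (\<lambda>t. fb t (x t)) t = x t" for t
    by (induction t) (auto simp: x_def)
  then show ?thesis by (intro exI[of _ "\<lambda>t. fb t (x t)"]) simp
qed

text \<open>Each involution permutes \<open>S\<close>, so by the pair bound every \<open>F i\<close>
  averages at least \<open>b\<close> over \<open>S\<close>. Some element reaches the average of the
  sum; this will be the sign pattern of the adversary.\<close>

lemma exists_ge_average_of_involutions:
  fixes F :: "'i \<Rightarrow> 's \<Rightarrow> real"
  assumes S: "finite S" "S \<noteq> {}"
    and inv: "\<And>i s. i \<in> I \<Longrightarrow> s \<in> S \<Longrightarrow> \<phi> i s \<in> S \<and> \<phi> i (\<phi> i s) = s"
    and pair: "\<And>i s. i \<in> I \<Longrightarrow> s \<in> S \<Longrightarrow> F i s + F i (\<phi> i s) \<ge> 2 * b"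
  shows "\<exists>s\<in>S. (\<Sum>i\<in>I. F i s) \<ge> real (card I) * b"
proof (rule ccontr)
  assume "\<not> ?thesis"
  then have "(\<Sum>s\<in>S. \<Sum>i\<in>I. F i s) < (\<Sum>s\<in>S. real (card I) * b)"
    using S by (intro sum_strict_mono) auto
  moreover have "(\<Sum>i\<in>I. real (card S) * b) \<le> (\<Sum>i\<in>I. \<Sum>s\<in>S. F i s)"
  proof (rule sum_mono)
    fix i assume i: "i \<in> I"
    have "(\<Sum>s\<in>S. F i (\<phi> i s)) = (\<Sum>s\<in>S. F i s)"
      using inv[OF i] by (intro sum.reindex_bij_witness[of _ "\<phi> i" "\<phi> i"]) auto
    moreover have "(\<Sum>s\<in>S. 2 * b) \<le> (\<Sum>s\<in>S. F i s + F i (\<phi> i s))"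
      using pair[OF i] by (intro sum_mono) auto
    ultimately show "real (card S) * b \<le> (\<Sum>s\<in>S. F i s)"
      by (simp add: sum.distrib)
  qed
  ultimately show False by (subst (asm) sum.swap) (simp add: mult_ac)
qed

lemma sum_lessThan_mult3: "(\<Sum>k<N * 3. g k) = (\<Sum>t<N. g (t * 3) + g (t * 3 + 1) + g (t * 3 + 2))"
  for g :: "nat \<Rightarrow> real"
proof (induction N)
  case (Suc N)
  have "Suc N * 3 = Suc (Suc (Suc (N * 3)))" by simp
  then show ?case using Suc by (simp only: sum.lessThan_Suc) simp
qed simp

lemma shift_norm_le:
  fixes x :: "nat \<Rightarrow> real"
  shows "(\<Sum>i<d. if s \<le> i then (x (i - s))\<^sup>2 else 0) \<le> (\<Sum>i<d. (x i)\<^sup>2)"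
proof -
  have "(\<Sum>i<d. if s \<le> i then (x (i - s))\<^sup>2 else 0) = (\<Sum>i\<in>{s..<d}. (x (i - s))\<^sup>2)"
    by (rule sum.mono_neutral_cong_right) auto
  also have "\<dots> = (\<Sum>i<d - s. (x i)\<^sup>2)"
    by (rule sum.reindex_bij_witness[of _ "\<lambda>i. i + s" "\<lambda>i. i - s"]) auto
  also have "\<dots> \<le> (\<Sum>i<d. (x i)\<^sup>2)"
    by (rule sum_mono2) auto
  finally show ?thesis .
qed

lemma vnorm_smult_unit_vec: "i < n \<Longrightarrow> vnorm (c \<cdot>\<^sub>v unit_vec n i) = \<bar>c\<bar>"
  by (simp add: vnorm_def power2_eq_square[symmetric])

text \<open>By the triangle inequality each spike is charged at most twice, for the jump to it and
  the jump away from it.\<close>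

lemma path_length_spikes:
  assumes \<sigma>: "\<And>t. \<bar>\<sigma> t\<bar> = (if t \<in> {W..<W + M} then \<theta> else 0)" and "\<theta> \<ge> 0" "W + M \<le> N" "i < n"
  shows "path_length N n (\<lambda>t. \<sigma> t \<cdot>\<^sub>v unit_vec n i) \<le> 2 * real M * \<theta>"
proof -
  let ?v = "unit_vec n i :: real vec"
  have total: "(\<Sum>t\<in>T. \<bar>\<sigma> t\<bar>) \<le> real M * \<theta>" if "finite T" for T
  proof -
    have "(\<Sum>t\<in>T. \<bar>\<sigma> t\<bar>) = (\<Sum>t\<in>T \<inter> {W..<W + M}. \<theta>)"
      unfolding \<sigma> by (rule sum.inter_restrict[OF that, symmetric])
    also have "\<dots> \<le> (\<Sum>t\<in>{W..<W + M}. \<theta>)" using assms(2) by (intro sum_mono2) auto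
    finally show ?thesis by simp
  qed
  have "\<sigma> t = 0" if "\<not> t < N" for t using \<sigma>[of t] that assms(3) by auto
  then have th: "(if t < N then \<sigma> t \<cdot>\<^sub>v ?v else 0\<^sub>v n) = \<sigma> t \<cdot>\<^sub>v ?v" for t by (auto simp: smult_vec_def)
  have diff: "vnorm (\<sigma> t \<cdot>\<^sub>v ?v - \<sigma> (t - 1) \<cdot>\<^sub>v ?v) \<le> \<bar>\<sigma> t\<bar> + \<bar>\<sigma> (t - 1)\<bar>" for t
  proof -
    have "\<sigma> t \<cdot>\<^sub>v ?v - \<sigma> (t - 1) \<cdot>\<^sub>v ?v = (\<sigma> t - \<sigma> (t - 1)) \<cdot>\<^sub>v ?v"
      by (rule eq_vecI) (auto simp: left_diff_distrib)
    then show ?thesis using assms(4) by (simp add: vnorm_smult_unit_vec)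
  qed
  have "path_length N n (\<lambda>t. \<sigma> t \<cdot>\<^sub>v ?v)
      = \<bar>\<sigma> 0\<bar> + (\<Sum>t\<in>{1..N}. vnorm (\<sigma> t \<cdot>\<^sub>v ?v - \<sigma> (t - 1) \<cdot>\<^sub>v ?v))"
    unfolding path_length_def Let_def th using assms(4) by (simp add: vnorm_smult_unit_vec)
  also have "\<dots> \<le> \<bar>\<sigma> 0\<bar> + (\<Sum>t\<in>{1..N}. \<bar>\<sigma> t\<bar> + \<bar>\<sigma> (t - 1)\<bar>)"
    by (intro add_left_mono sum_mono diff)
  also have "\<dots> = (\<bar>\<sigma> 0\<bar> + (\<Sum>t\<in>{1..N}. \<bar>\<sigma> t\<bar>)) + (\<Sum>t\<in>{1..N}. \<bar>\<sigma> (t - 1)\<bar>)"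
    by (simp add: sum.distrib)
  also have "\<bar>\<sigma> 0\<bar> + (\<Sum>t\<in>{1..N}. \<bar>\<sigma> t\<bar>) = (\<Sum>t\<in>insert 0 {1..N}. \<bar>\<sigma> t\<bar>)"
    by simp
  also have "(\<Sum>t\<in>{1..N}. \<bar>\<sigma> (t - 1)\<bar>) = (\<Sum>t\<in>{..<N}. \<bar>\<sigma> t\<bar>)"
    by (rule sum.reindex_bij_witness[of _ Suc "\<lambda>t. t - 1"]) auto
  also have "(\<Sum>t\<in>insert 0 {1..N}. \<bar>\<sigma> t\<bar>) + (\<Sum>t\<in>{..<N}. \<bar>\<sigma> t\<bar>) \<le> real M * \<theta> + real M * \<theta>"
    by (intro add_mono total) auto
  finally show ?thesis by (simp add: mult_ac)
qed

section \<open>Causality of online algorithms\<close>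

lemma alg_input_carrier: "alg_input m A B alg fs gs t \<in> carrier_vec m"
  by (simp add: alg_input_def as_input_def Let_def)

lemma alg_hist_length: "length (alg_hist m A B alg fs gs t) = Suc t"
  by (induction t) (auto simp: Let_def)

lemma alg_hist_last:
  "last (alg_hist m A B alg fs gs t) = states A B (alg_input m A B alg fs gs) t"
  by (induction t) (auto simp: Let_def alg_input_def)

text \<open>Induction on time: stage costs that agree below \<open>t + W\<close> produce the same
  history, hence the same state and input at time \<open>t\<close>.\<close>

lemma alg_input_causal:
  assumes on: "online W alg" and eq: "\<And>s. s < t + W \<Longrightarrow> fs s = fs' s"
  shows "alg_input m A B alg fs gs t = alg_input m A B alg fs' gs t
    \<and> states A B (alg_input m A B alg fs gs) t = states A B (alg_input m A B alg fs' gs) t"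
proof -
  have input: "alg t x fs gs = alg t x fs' gs" if "\<And>s. s < t + W \<Longrightarrow> fs s = fs' s" for t x
    using on that unfolding online_def by blast
  have "alg_hist m A B alg fs gs t = alg_hist m A B alg fs' gs t"
    using eq
  proof (induction t)
    case (Suc t)
    then have "alg_hist m A B alg fs gs t = alg_hist m A B alg fs' gs t" by simp
    moreover have "alg t x fs gs = alg t x fs' gs" for x
      by (rule input) (use Suc.prems in simp)
    ultimately show ?case by (simp add: Let_def)
  qed simp
  then show ?thesis
    using input[OF eq] by (auto simp: alg_input_def simp flip: alg_hist_last)
qed

section \<open>The hard instance and its Riccati equation\<close>

locale cyclic_shift =
  fixes p :: nat and \<rho> :: real
  assumes p: "p \<ge> 1" and \<rho>: "0 < \<rho>" "\<rho> < 1"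
begin

text \<open>\<open>lo\<close> and \<open>hi\<close> are the minimum and maximum of
  \<open>|1 - \<rho> w|^2 / \<rho>\<close> over the unit circle, the symbol of the chain's
  Hessian.\<close>

definition lo :: real where "lo = (1 - \<rho>)\<^sup>2 / \<rho>"
definition hi :: real where "hi = (1 + \<rho>)\<^sup>2 / \<rho>"
text \<open>A value is charged \<open>q\<close> in each of the \<open>p\<close> coordinates of the
  chain. The total \<open>p * q = lo\<close> is what makes the last diagonal entry of the DARE
  solution \<open>1 / \<rho> - 1\<close>.\<close>

definition q :: real where "q = lo / p"

definition A :: "real mat" where
  "A = mat (p + 2) (p + 2) (\<lambda>(i, j). if (i + 1 < p \<and> j = i + 1) \<or> (i + 1 = p \<and> j = 0) then 1 else 0)"

definition B :: "real mat" where
  "B = mat (p + 2) 3 (\<lambda>(i, j). if i + 1 = p + j then 1 else 0)"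

definition k :: "nat \<Rightarrow> nat" where "k i = (if i = 0 then 0 else p + i - 1)"

text \<open>In a scalar block every value is charged once as an input and once as the state it
  produces, at the final time through \<open>Pd\<close>. Two halves add up to \<open>lo\<close>,
  respectively \<open>hi\<close>.\<close>

definition Qd :: "nat \<Rightarrow> real" where "Qd i = (if i < p then q else if i = p then lo / 2 else hi / 2)"
definition Rd :: "nat \<Rightarrow> real" where "Rd j = (if j = 0 then 1 else if j = 1 then lo / 2 else hi / 2)"
text \<open>A value in coordinate \<open>i\<close> of the chain is charged \<open>q\<close> in each
  of the coordinates \<open>i, ..., 0\<close>; the summand \<open>1 - \<rho>\<close> is the optimal
  cost of all later cycles.\<close>

definition Pd :: "nat \<Rightarrow> real" where
  "Pd i = (if i < p then q * (real i + 1) + (1 - \<rho>) else if i = p then lo / 2 else hi / 2)"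

lemma lo_pos: "lo > 0" and hi_pos: "hi > 0" and q_pos: "q > 0"
  using \<rho> p by (auto simp: lo_def hi_def q_def)

lemma Pd_last: "Pd (p - 1) = 1 / \<rho> - 1"
proof -
  have "Pd (p - 1) = q * real p + (1 - \<rho>)" using p by (simp add: Pd_def of_nat_diff)
  also have "\<dots> = 1 / \<rho> - 1"
    using p \<rho> by (simp add: q_def lo_def power2_eq_square field_simps)
  finally show ?thesis .
qed

lemma canonical: "canonical_form (p + 2) 3 A B k p"
proof -
  have "(\<lambda>i. k i - k (i - 1)) ` {1..3} = {p, 1}"
  proof -
    have "{1..3::nat} = {1, 2, 3}" by auto
    then show ?thesis using p by (auto simp: k_def)
  qed
  then have "Max ((\<lambda>i. k i - k (i - 1)) ` {1..3}) = p" using p by auto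
  moreover have "A $$ (r, c) = (if c = Suc r then 1 else 0)"
    if "r < p + 2" "Suc r \<notin> k ` {1..3}" "c < p + 2" for r c
  proof -
    have "Suc r \<noteq> p" "Suc r \<noteq> p + 1" "Suc r \<noteq> p + 2"
      using that(2) by (auto simp: k_def image_iff dest: bspec[of _ _ 1] bspec[of _ _ 2] bspec[of _ _ 3])
    then show ?thesis using that by (auto simp: A_def)
  qed
  ultimately show ?thesis
    using p by (auto simp: canonical_form_def B_def k_def) (auto simp: A_def)
qed

section \<open>Positive definiteness and the Riccati equation\<close>

lemma posdef_Q: "posdef (p + 2) (mat_diag (p + 2) Qd)"
  using lo_pos hi_pos q_pos by (intro posdef_mat_diag) (auto simp: Qd_def)

lemma posdef_R: "posdef 3 (mat_diag 3 Rd)"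
  using lo_pos hi_pos by (intro posdef_mat_diag) (auto simp: Rd_def)

lemma Pd_pos: "Pd i > 0"
  using lo_pos hi_pos q_pos \<rho> by (auto simp: Pd_def intro!: add_nonneg_pos)

text \<open>The columns of \<open>B\<close> are distinct unit vectors, so this congruence selects
  the diagonal entries from \<open>p - 1\<close> on.\<close>

lemma BtDB: "transpose_mat B * mat_diag (p + 2) f * B = mat_diag 3 (\<lambda>j. f (p - 1 + j))"
proof -
  have "transpose_mat B * mat_diag (p + 2) f = mat 3 (p + 2) (\<lambda>(i, j). B $$ (j, i) * f j)"
    by (subst mat_diag_mult_right[of _ 3]) (auto simp: B_def)
  moreover have "mat 3 (p + 2) (\<lambda>(i, j). B $$ (j, i) * f j) * B = mat_diag 3 (\<lambda>j. f (p - 1 + j))"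
  proof (rule eq_matI)
    fix i j assume "i < dim_row (mat_diag 3 (\<lambda>j. f (p - 1 + j)))" "j < dim_col (mat_diag 3 (\<lambda>j. f (p - 1 + j)))"
    then have ij: "i < 3" "j < 3" by (auto simp: mat_diag_def)
    have "(mat 3 (p + 2) (\<lambda>(i, j). B $$ (j, i) * f j) * B) $$ (i, j)
        = (\<Sum>r<p + 2. (if r + 1 = p + i then 1 else 0) * f r * (if r + 1 = p + j then 1 else 0))"
      using ij by (auto simp: B_def scalar_prod_def atLeast0LessThan simp del: sum.lessThan_Suc intro!: sum.cong)
    also have "\<dots> = (\<Sum>r<p + 2. if r = p - 1 + i then if i = j then f r else 0 else 0)"
      using p by (intro sum.cong) auto
    also have "\<dots> = (if i = j then f (p - 1 + i) else 0)"
      using ij p by (subst sum.delta) auto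
    finally show "(mat 3 (p + 2) (\<lambda>(i, j). B $$ (j, i) * f j) * B) $$ (i, j)
        = mat_diag 3 (\<lambda>j. f (p - 1 + j)) $$ (i, j)"
      using ij by (simp add: mat_diag_def)
  qed (auto simp: B_def mat_diag_def)
  ultimately show ?thesis by simp
qed

lemma BDBt: "B * mat_diag 3 g * transpose_mat B = mat_diag (p + 2) (\<lambda>i. if p - 1 \<le> i then g (i - (p - 1)) else 0)"
proof -
  let ?D = "mat_diag (p + 2) (\<lambda>i. if p - 1 \<le> i then g (i - (p - 1)) else 0)"
  have "B * mat_diag 3 g = mat (p + 2) 3 (\<lambda>(i, j). B $$ (i, j) * g j)"
    by (subst mat_diag_mult_right[of _ "p + 2"]) (auto simp: B_def)
  moreover have "mat (p + 2) 3 (\<lambda>(i, j). B $$ (i, j) * g j) * transpose_mat B = ?D"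
  proof (rule eq_matI)
    fix i j assume "i < dim_row ?D" "j < dim_col ?D"
    then have ij: "i < p + 2" "j < p + 2" by (auto simp: mat_diag_def)
    have "(mat (p + 2) 3 (\<lambda>(i, j). B $$ (i, j) * g j) * transpose_mat B) $$ (i, j)
        = (\<Sum>r<3. (if i + 1 = p + r then 1 else 0) * g r * (if j + 1 = p + r then 1 else 0))"
      using ij by (auto simp: B_def scalar_prod_def atLeast0LessThan simp del: sum.lessThan_Suc intro!: sum.cong)
    also have "\<dots> = (\<Sum>r<3. if r = i - (p - 1) then if p - 1 \<le> i \<and> i = j then g r else 0 else 0)"
      using p by (intro sum.cong) auto
    also have "\<dots> = (if p - 1 \<le> i \<and> i = j then g (i - (p - 1)) else 0)"
      using ij p by (subst sum.delta) auto
    finally show "(mat (p + 2) 3 (\<lambda>(i, j). B $$ (i, j) * g j) * transpose_mat B) $$ (i, j) = ?D $$ (i, j)"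
      using ij by (simp add: mat_diag_def)
  qed (auto simp: B_def mat_diag_def)
  ultimately show ?thesis by simp
qed

text \<open>Column \<open>i < p\<close> of \<open>A\<close> is the unit vector of the cyclic
  predecessor \<open>pr i\<close>, and the last two columns vanish. The congruence thus rotates the
  first \<open>p\<close> diagonal entries.\<close>

lemma AtDA:
  "transpose_mat A * mat_diag (p + 2) f * A
    = mat_diag (p + 2) (\<lambda>i. if i = 0 then f (p - 1) else if i < p then f (i - 1) else 0)"
proof -
  let ?D = "mat_diag (p + 2) (\<lambda>i. if i = 0 then f (p - 1) else if i < p then f (i - 1) else 0)"
  define pr where "pr i = (if i = 0 then p - 1 else i - 1)" for i
  have A: "A $$ (r, i) = (if i < p \<and> r = pr i then 1 else 0)" if "r < p + 2" "i < p + 2" for r i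
    using that p by (auto simp: A_def pr_def)
  have pr_inj: "i = j" if "pr i = pr j" "i < p" "j < p" for i j
    using that by (auto simp: pr_def split: if_splits)
  have "transpose_mat A * mat_diag (p + 2) f = mat (p + 2) (p + 2) (\<lambda>(i, j). A $$ (j, i) * f j)"
    by (subst mat_diag_mult_right[of _ "p + 2"]) (auto simp: A_def)
  moreover have "mat (p + 2) (p + 2) (\<lambda>(i, j). A $$ (j, i) * f j) * A = ?D"
  proof (rule eq_matI)
    fix i j assume "i < dim_row ?D" "j < dim_col ?D"
    then have ij: "i < p + 2" "j < p + 2" by (auto simp: mat_diag_def)
    have dA: "dim_row A = p + 2" "dim_col A = p + 2" by (simp_all add: A_def)
    have "(mat (p + 2) (p + 2) (\<lambda>(i, j). A $$ (j, i) * f j) * A) $$ (i, j)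
        = (\<Sum>r<p + 2. (A $$ (r, i) * f r) * A $$ (r, j))"
      using ij dA by (auto simp: scalar_prod_def atLeast0LessThan simp del: sum.lessThan_Suc intro!: sum.cong)
    also have "\<dots> = (\<Sum>r<p + 2. if r = pr i then if i < p \<and> i = j then f r else 0 else 0)"
      using A ij pr_inj[of i j] by (intro sum.cong) auto
    also have "\<dots> = (if i < p \<and> i = j then f (pr i) else 0)"
      using ij p by (subst sum.delta) (auto simp: pr_def)
    finally show "(mat (p + 2) (p + 2) (\<lambda>(i, j). A $$ (j, i) * f j) * A) $$ (i, j) = ?D $$ (i, j)"
      using ij p by (auto simp: mat_diag_def pr_def)
  qed (auto simp: A_def mat_diag_def)
  ultimately show ?thesis by simp
qed

text \<open>Everything is diagonal, so the equation becomes \<open>Pd i = Qd i + Pd (i - 1)\<close>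
  around the cycle. Control acts only at the wrap-around, where it lowers
  \<open>1 / \<rho> - 1\<close> to \<open>1 - \<rho>\<close>; in the scalar blocks \<open>Pd\<close>
  equals \<open>Qd\<close>.\<close>

lemma dare:
  "dare_solution (p + 2) 3 A B (mat_diag (p + 2) Qd) (mat_diag 3 Rd) (mat_diag (p + 2) Pd)"
proof -
  let ?P = "mat_diag (p + 2) Pd" and ?n = "p + 2"
  \<comment> \<open>The diagonal of \<open>B^T P B + R\<close>: \<open>(1 / \<rho> - 1) + 1\<close>
    for the chain and two halves for each scalar block.\<close>
  define S where "S j = (if j = 0 then 1 / \<rho> else if j = 1 then lo else hi)" for j :: nat
  define M where "M = mat_diag 3 (\<lambda>j. 1 / S j)"
  have S: "S j > 0" for j using lo_pos hi_pos \<rho> by (auto simp: S_def)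
  have carr: "A \<in> carrier_mat ?n ?n" "B \<in> carrier_mat ?n 3" "M \<in> carrier_mat 3 3" "?P \<in> carrier_mat ?n ?n"
    by (simp_all add: A_def B_def M_def)
  have PR: "Pd (p - 1 + j) + Rd j = S j" if "j < 3" for j
  proof -
    have "j = 0 \<or> j = 1 \<or> j = 2" using that by auto
    moreover have "p - 1 + 2 = p + 1" using p by simp
    ultimately show ?thesis using p Pd_last by (auto simp: Pd_def S_def Rd_def)
  qed
  have BPB: "transpose_mat B * ?P * B + mat_diag 3 Rd = mat_diag 3 S"
    unfolding BtDB mat_diag_add using PR by (intro mat_diag_cong)
  have inv: "M * mat_diag 3 S = 1\<^sub>m 3" "mat_diag 3 S * M = 1\<^sub>m 3"
    using S less_imp_neq[OF S] by (simp_all add: M_def)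
  have "?P * B * M * transpose_mat B * ?P = ?P * (B * M * transpose_mat B) * ?P"
    using carr by (simp add: assoc_mult_mat[of _ ?n ?n _ 3 _ 3] assoc_mult_mat[of _ ?n ?n _ 3 _ ?n]
        mult_carrier_mat[of _ ?n 3])
  also have "\<dots> = mat_diag ?n (\<lambda>i. Pd i * (if p - 1 \<le> i then 1 / S (i - (p - 1)) else 0) * Pd i)"
    by (simp add: M_def BDBt)
  finally have PBP: "?P - ?P * B * M * transpose_mat B * ?P
      = mat_diag ?n (\<lambda>i. Pd i - Pd i * (if p - 1 \<le> i then 1 / S (i - (p - 1)) else 0) * Pd i)"
    by (simp add: mat_diag_minus)
  have last: "Pd (p - 1) - Pd (p - 1) * (1 / S 0) * Pd (p - 1) = 1 - \<rho>"
    unfolding Pd_last S_def using \<rho> by (simp add: field_simps)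
  have "?P = mat_diag ?n Qd + transpose_mat A * (?P - ?P * B * M * transpose_mat B * ?P) * A"
    unfolding PBP AtDA mat_diag_add
  proof (rule mat_diag_cong)
    fix i assume "i < ?n"
    consider "i = 0" | "0 < i" "i < p" | "p \<le> i" by linarith
    then show "Pd i = Qd i + (if i = 0 then Pd (p - 1)
          - Pd (p - 1) * (if p - 1 \<le> p - 1 then 1 / S (p - 1 - (p - 1)) else 0) * Pd (p - 1)
        else if i < p then Pd (i - 1) - Pd (i - 1) * (if p - 1 \<le> i - 1 then 1 / S (i - 1 - (p - 1)) else 0) * Pd (i - 1)
        else 0)"
    proof cases
      case 1
      have "Pd 0 = Qd 0 + (1 - \<rho>)" using p by (simp add: Pd_def Qd_def)
      then show ?thesis using 1 last by simp
    next
      case 2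
      then show ?thesis by (auto simp: Pd_def Qd_def algebra_simps of_nat_diff)
    next
      case 3
      then show ?thesis using p by (simp add: Pd_def Qd_def)
    qed
  qed
  moreover have "posdef ?n ?P" using Pd_pos by (intro posdef_mat_diag)
  ultimately show ?thesis
    unfolding dare_solution_def BPB using carr inv by blast
qed

section \<open>Cost as a sum of squares\<close>

lemma dims [simp]: "dim_row A = p + 2" "dim_col A = p + 2" "dim_row B = p + 2" "dim_col B = 3"
  by (simp_all add: A_def B_def)

lemma row_A:
  assumes "i < p + 2" "x \<in> carrier_vec (p + 2)"
  shows "row A i \<bullet> x = (if i + 1 < p then x $ (i + 1) else if i + 1 = p then x $ 0 else 0)"
proof -
  have "row A i \<bullet> x = (\<Sum>j<p + 2. A $$ (i, j) * x $ j)"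
    using assms by (simp add: scalar_prod_def atLeast0LessThan del: sum.lessThan_Suc)
  also have "\<dots> = (\<Sum>j<p + 2. if j = (if i + 1 < p then i + 1 else 0)
      then if i + 1 \<le> p then x $ j else 0 else 0)"
    using assms(1) by (intro sum.cong) (auto simp: A_def)
  also have "\<dots> = (if i + 1 \<le> p then x $ (if i + 1 < p then i + 1 else 0) else 0)"
    using assms(1) by (subst sum.delta) auto
  finally have eq: "row A i \<bullet> x = (if i + 1 \<le> p then x $ (if i + 1 < p then i + 1 else 0) else 0)" .
  show ?thesis unfolding eq by auto
qed

lemma row_B:
  assumes "i < p + 2" "y \<in> carrier_vec 3"
  shows "row B i \<bullet> y = (if i + 1 < p then 0 else y $ (i + 1 - p))"
proof -
  have "row B i \<bullet> y = (\<Sum>j<3. B $$ (i, j) * y $ j)"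
    using assms by (simp add: scalar_prod_def atLeast0LessThan del: sum.lessThan_Suc)
  also have "\<dots> = (\<Sum>j<3. if j = i + 1 - p then if p \<le> i + 1 then y $ j else 0 else 0)"
    using assms(1) by (intro sum.cong) (auto simp: B_def)
  also have "\<dots> = (if p \<le> i + 1 then y $ (i + 1 - p) else 0)"
    using assms(1) by (subst sum.delta) auto
  finally have eq: "row B i \<bullet> y = (if p \<le> i + 1 then y $ (i + 1 - p) else 0)" .
  show ?thesis unfolding eq by auto
qed

lemma states_carrier: "states A B u t \<in> carrier_vec (p + 2)"
  by (rule carrier_vecI, cases t) simp_all

lemma step_index:
  assumes "x \<in> carrier_vec (p + 2)" "y \<in> carrier_vec 3" "i < p + 2"
  shows "(A *\<^sub>v x + B *\<^sub>v y) $ i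
    = (if i + 1 < p then x $ (i + 1) else if i + 1 = p then x $ 0 + y $ 0 else y $ (i + 1 - p))"
proof -
  have "(A *\<^sub>v x + B *\<^sub>v y) $ i = row A i \<bullet> x + row B i \<bullet> y" using assms(3) by simp
  then show ?thesis using assms by (simp add: row_A row_B)
qed

text \<open>For targets that vanish from time \<open>N\<close> on, the truncation is exact:
  \<open>p \<ge> 1\<close> puts every term with \<open>i \<ge> N\<close> beyond the horizon.\<close>

definition H :: "nat \<Rightarrow> (nat \<Rightarrow> real) \<Rightarrow> nat \<Rightarrow> real" where
  "H N \<sigma> t = (\<Sum>i<N. \<rho> ^ i * \<sigma> (t + i * p))"

lemma H_rec:
  assumes "\<forall>t\<ge>N. \<sigma> t = 0"
  shows "H N \<sigma> t = \<sigma> t + \<rho> * H N \<sigma> (t + p)"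
proof -
  have "N * 1 \<le> N * p" using p by (intro mult_le_mono) auto
  then have "N \<le> t + N * p" by linarith
  then have "H N \<sigma> t = (\<Sum>i<Suc N. \<rho> ^ i * \<sigma> (t + i * p))"
    using assms by (simp add: H_def)
  also have "\<dots> = \<sigma> t + (\<Sum>i<N. \<rho> ^ Suc i * \<sigma> (t + Suc i * p))"
    by (subst sum.lessThan_Suc_shift) simp
  also have "\<dots> = \<sigma> t + \<rho> * H N \<sigma> (t + p)"
    by (simp add: H_def sum_distrib_left add.assoc mult.assoc)
  finally show ?thesis .
qed

lemma H_eq_0: "\<forall>t\<ge>N. \<sigma> t = 0 \<Longrightarrow> N \<le> t \<Longrightarrow> H N \<sigma> t = 0"
  by (auto simp: H_def intro!: sum.neutral)

text \<open>
  Coordinate \<open>i\<close> of the state at time \<open>t\<close> is \<open>z\<^sub>s\<close> with \<open>s = t + i + 1 - p\<close>; it meets its target when it sits in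
  coordinate \<open>e\<close>, that is at time \<open>t + i - e\<close>. Once this has passed, only the targets of \<open>z\<^bsub>s+p\<^esub>\<close> and its successors matter.
\<close>

definition lin_coeff :: "(nat \<Rightarrow> real) \<Rightarrow> nat \<Rightarrow> nat \<Rightarrow> nat \<Rightarrow> real" where
  "lin_coeff h e t i = (if e \<le> i then q * h (t + i - e) else q * \<rho> * h (t + p + i - e))"

text \<open>The value function without its constant part, which is collected in
  \<open>opt_cost\<close>.\<close>

definition V :: "(nat \<Rightarrow> real) \<Rightarrow> nat \<Rightarrow> nat \<Rightarrow> (nat \<Rightarrow> real) \<Rightarrow> real" where
  "V h e t X = (1/2) * (\<Sum>i<p + 2. Pd i * (X i)\<^sup>2) - (\<Sum>i<p. lin_coeff h e t i * X i)"

text \<open>Stage cost plus increment of \<open>V\<close> is a completed square in the new chain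
  value. The shifted coordinates cancel; only the wrap-around and the coordinate \<open>e\<close>,
  where a target is met, contribute.\<close>

lemma bellman_step:
  assumes e: "e < p" and h: "h t = s + \<rho> * h (t + p)"
    and Y: "\<And>i. i < p + 2 \<Longrightarrow>
      Y i = (if i + 1 < p then X (i + 1) else if i + 1 = p then X 0 + U 0 else U (i + 1 - p))"
  shows "(1/2) * ((\<Sum>i<p + 2. Qd i * (X i - (if i = e then s else 0))\<^sup>2) + (\<Sum>j<3. Rd j * (U j)\<^sup>2))
      + (V h e (Suc t) Y - V h e t X)
    = 1 / (2 * \<rho>) * (X 0 + U 0 - \<rho> * X 0 - \<rho> * q * h (t + p - e))\<^sup>2 + lo / 2 * (U 1)\<^sup>2 + hi / 2 * (U 2)\<^sup>2
      + (q * s\<^sup>2 / 2 - \<rho> * (q * h (t + p - e))\<^sup>2 / 2)"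
proof -
  obtain p' where p': "p = Suc p'" using p by (cases p) auto
  define g where "g = h (t + p - e)"
  \<comment> \<open>Sums over \<open>Y\<close> are split at the last coordinate and sums over
    \<open>X\<close> at the first, so that the shifted remainders agree term by term.\<close>
  have split_last: "(\<Sum>i<p. f i) = (\<Sum>i<p'. f i) + f p'"
    and split_first: "(\<Sum>i<p. f i) = f 0 + (\<Sum>i<p'. f (i + 1))" for f :: "nat \<Rightarrow> real"
    unfolding p' by (rule sum.lessThan_Suc, subst sum.lessThan_Suc_shift, simp)
  have lastp: "Pd p' = 1 / \<rho> - 1" using Pd_last p' by simp
  have Ylast: "Y p' = X 0 + U 0" using Y[of p'] p' by simp
  have Yshift: "Y i = X (i + 1)" if "i \<in> {..<p'}" for i using Y[of i] p' that by simp
  have "(\<Sum>i<p. Qd i * (X i - (if i = e then s else 0))\<^sup>2)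
      = (\<Sum>i<p. q * (X i)\<^sup>2 + (if i = e then q * s\<^sup>2 - 2 * q * s * X i else 0))"
    by (intro sum.cong) (auto simp: Qd_def power2_eq_square algebra_simps)
  also have "\<dots> = (\<Sum>i<p. q * (X i)\<^sup>2) + (q * s\<^sup>2 - 2 * q * s * X e)"
    using e by (simp add: sum.distrib)
  also have "(\<Sum>i<p. q * (X i)\<^sup>2) = q * (X 0)\<^sup>2 + (\<Sum>i<p'. q * (X (i + 1))\<^sup>2)"
    by (rule split_first)
  finally have Q: "(\<Sum>i<p + 2. Qd i * (X i - (if i = e then s else 0))\<^sup>2)
      = q * (X 0)\<^sup>2 + (\<Sum>i<p'. q * (X (i + 1))\<^sup>2) + (q * s\<^sup>2 - 2 * (q * s * X e))
        + lo / 2 * (X p)\<^sup>2 + hi / 2 * (X (p + 1))\<^sup>2"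
    using e by (simp add: Qd_def mult.assoc)
  have "(\<Sum>i<p. Pd i * (Y i)\<^sup>2) = (\<Sum>i<p'. Pd i * (X (i + 1))\<^sup>2) + (1 / \<rho> - 1) * (X 0 + U 0)\<^sup>2"
    unfolding split_last using Ylast lastp Yshift by simp
  then have PY: "(\<Sum>i<p + 2. Pd i * (Y i)\<^sup>2)
      = (\<Sum>i<p'. Pd i * (X (i + 1))\<^sup>2) + (1 / \<rho> - 1) * (X 0 + U 0)\<^sup>2 + lo / 2 * (U 1)\<^sup>2 + hi / 2 * (U 2)\<^sup>2"
    using Y[of p] Y[of "p + 1"] by (simp add: Pd_def numeral_2_eq_2)
  have "(\<Sum>i<p. Pd i * (X i)\<^sup>2) = Pd 0 * (X 0)\<^sup>2 + (\<Sum>i<p'. Pd (i + 1) * (X (i + 1))\<^sup>2)"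
    by (rule split_first)
  also have "(\<Sum>i<p'. Pd (i + 1) * (X (i + 1))\<^sup>2) = (\<Sum>i<p'. Pd i * (X (i + 1))\<^sup>2 + q * (X (i + 1))\<^sup>2)"
  proof (intro sum.cong refl)
    fix i assume "i \<in> {..<p'}"
    then have "i < p" "i + 1 < p" unfolding p' by auto
    then show "Pd (i + 1) * (X (i + 1))\<^sup>2 = Pd i * (X (i + 1))\<^sup>2 + q * (X (i + 1))\<^sup>2"
      by (simp add: Pd_def algebra_simps)
  qed
  also have "Pd 0 = q + (1 - \<rho>)" using p by (simp add: Pd_def)
  finally have PX: "(\<Sum>i<p + 2. Pd i * (X i)\<^sup>2)
      = q * (X 0)\<^sup>2 + (1 - \<rho>) * (X 0)\<^sup>2 + (\<Sum>i<p'. Pd i * (X (i + 1))\<^sup>2) + (\<Sum>i<p'. q * (X (i + 1))\<^sup>2)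
        + lo / 2 * (X p)\<^sup>2 + hi / 2 * (X (p + 1))\<^sup>2"
    by (simp add: Pd_def sum.distrib distrib_right)
  have LY: "(\<Sum>i<p. lin_coeff h e (Suc t) i * Y i) = (\<Sum>i<p'. lin_coeff h e (Suc t) i * X (i + 1)) + q * g * (X 0 + U 0)"
  proof -
    have "e \<le> p'" "Suc t + p' - e = t + p - e" using e p' by auto
    then have "lin_coeff h e (Suc t) p' = q * g" by (simp only: lin_coeff_def g_def if_True)
    then show ?thesis unfolding split_last using Ylast Yshift by simp
  qed
  have "(\<Sum>i<p. lin_coeff h e t i * X i) = lin_coeff h e t 0 * X 0 + (\<Sum>i<p'. lin_coeff h e t (i + 1) * X (i + 1))"
    by (rule split_first)
  also have "(\<Sum>i<p'. lin_coeff h e t (i + 1) * X (i + 1))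
      = (\<Sum>i<p'. lin_coeff h e (Suc t) i * X (i + 1) + (if i + 1 = e then q * s * X e else 0))"
  proof (intro sum.cong refl)
    fix i assume "i \<in> {..<p'}"
    \<comment> \<open>Moving one coordinate down keeps the pending targets, except when the value
      leaves \<open>e\<close>: its current target is then settled, and the recursion for
      \<open>h\<close> accounts for \<open>q * s\<close>.\<close>
    have "lin_coeff h e t (i + 1) = lin_coeff h e (Suc t) i + (if i + 1 = e then q * s else 0)"
    proof -
      have l1: "lin_coeff h e t (i + 1)
          = (if e \<le> i + 1 then q * h (Suc t + i - e) else q * \<rho> * h (Suc t + p + i - e))"
        by (simp add: lin_coeff_def)
      show ?thesis
      proof (cases "i + 1 = e")
        case True
        then have idx: "Suc t + i - e = t" "Suc t + p + i - e = t + p" "e \<le> i + 1" "\<not> e \<le> i" by auto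
        show ?thesis
          unfolding l1 lin_coeff_def[of h e "Suc t" i] idx(1,2) using idx(3,4) True h
          by (simp add: algebra_simps)
      next
        case False
        then show ?thesis by (cases "e \<le> i") (auto simp: l1 lin_coeff_def)
      qed
    qed
    then show "lin_coeff h e t (i + 1) * X (i + 1)
        = lin_coeff h e (Suc t) i * X (i + 1) + (if i + 1 = e then q * s * X e else 0)"
      by (auto simp: algebra_simps)
  qed
  also have "\<dots> = (\<Sum>i<p'. lin_coeff h e (Suc t) i * X (i + 1)) + (if 0 < e then q * s * X e else 0)"
  proof -
    have "(\<Sum>i<p'. if i + 1 = e then q * s * X e else 0) = (\<Sum>i<p'. if i = e - 1 then if 0 < e then q * s * X e else 0 else 0)"
      by (intro sum.cong) auto
    also have "\<dots> = (if 0 < e then q * s * X e else 0)"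
      using e p' by (subst sum.delta) auto
    finally show ?thesis by (simp add: sum.distrib)
  qed
  \<comment> \<open>If \<open>e = 0\<close>, the target is met in coordinate \<open>0\<close>, and
    expanding \<open>q * h t\<close> by the recursion supplies the missing
    \<open>q * s * X e\<close>.\<close>
  also have "lin_coeff h e t 0 * X 0 + ((\<Sum>i<p'. lin_coeff h e (Suc t) i * X (i + 1)) + (if 0 < e then q * s * X e else 0))
      = q * \<rho> * g * X 0 + q * s * X e + (\<Sum>i<p'. lin_coeff h e (Suc t) i * X (i + 1))"
    using h by (simp add: lin_coeff_def g_def algebra_simps)
  finally have LX: "(\<Sum>i<p. lin_coeff h e t i * X i)
      = q * \<rho> * g * X 0 + q * s * X e + (\<Sum>i<p'. lin_coeff h e (Suc t) i * X (i + 1))" .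
  have RU: "(\<Sum>j<3. Rd j * (U j)\<^sup>2) = (U 0)\<^sup>2 + lo / 2 * (U 1)\<^sup>2 + hi / 2 * (U 2)\<^sup>2"
    by (simp add: Rd_def numeral_3_eq_3 numeral_2_eq_2)
  have "(U 0)\<^sup>2 / 2 + (1 / \<rho> - 1) * (X 0 + U 0)\<^sup>2 / 2 - (1 - \<rho>) * (X 0)\<^sup>2 / 2
      - q * g * (X 0 + U 0) + q * \<rho> * g * X 0
    = 1 / (2 * \<rho>) * (X 0 + U 0 - \<rho> * X 0 - \<rho> * q * g)\<^sup>2 - \<rho> * (q * g)\<^sup>2 / 2"
    using \<rho>(1) by (simp add: field_simps power2_eq_square)
  then show ?thesis
    unfolding V_def Q PY PX LY LX RU g_def[symmetric] by argo
qed

definition opt_cost :: "nat \<Rightarrow> (nat \<Rightarrow> real) \<Rightarrow> nat \<Rightarrow> real" where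
  "opt_cost N \<sigma> e = (\<Sum>t<N. q * (\<sigma> t)\<^sup>2 / 2 - \<rho> * (q * H N \<sigma> (t + p - e))\<^sup>2 / 2)"

text \<open>The first two summands form the chain value entering the last coordinate at time
  \<open>t + 1\<close>. It first meets a target at time \<open>t + p - e\<close>, hence the index of
  \<open>H\<close>.\<close>

definition excess :: "nat \<Rightarrow> (nat \<Rightarrow> real) \<Rightarrow> nat \<Rightarrow> (nat \<Rightarrow> real vec) \<Rightarrow> nat \<Rightarrow> real" where
  "excess N \<sigma> e u t = states A B u t $ 0 + u t $ 0 - \<rho> * states A B u t $ 0 - \<rho> * q * H N \<sigma> (t + p - e)"

abbreviation "Q \<equiv> mat_diag (p + 2) Qd"
abbreviation "R \<equiv> mat_diag 3 Rd"
abbreviation "P \<equiv> mat_diag (p + 2) Pd"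
abbreviation "target \<sigma> e \<equiv> \<lambda>t. \<sigma> t \<cdot>\<^sub>v unit_vec (p + 2) e"

lemma J_eq:
  assumes \<sigma>: "\<forall>t\<ge>N. \<sigma> t = 0" and e: "e < p" and u: "\<forall>t. u t \<in> carrier_vec 3"
  shows "J N A B Q R P (target \<sigma> e) u
    = (\<Sum>t<N. 1 / (2 * \<rho>) * (excess N \<sigma> e u t)\<^sup>2 + lo / 2 * (u t $ 1)\<^sup>2 + hi / 2 * (u t $ 2)\<^sup>2) + opt_cost N \<sigma> e"
proof -
  let ?x = "states A B u" and ?h = "H N \<sigma>"
  let ?V = "\<lambda>t. V ?h e t (\<lambda>i. ?x t $ i)"
  have step: "(1/2) * ((?x t - target \<sigma> e t) \<bullet> (Q *\<^sub>v (?x t - target \<sigma> e t)) + u t \<bullet> (R *\<^sub>v u t))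
      + (?V (Suc t) - ?V t)
     = 1 / (2 * \<rho>) * (excess N \<sigma> e u t)\<^sup>2 + lo / 2 * (u t $ 1)\<^sup>2 + hi / 2 * (u t $ 2)\<^sup>2
      + (q * (\<sigma> t)\<^sup>2 / 2 - \<rho> * (q * ?h (t + p - e))\<^sup>2 / 2)" for t
  proof -
    have "(?x t - target \<sigma> e t) \<bullet> (Q *\<^sub>v (?x t - target \<sigma> e t))
        = (\<Sum>i<p + 2. Qd i * ((?x t - target \<sigma> e t) $ i)\<^sup>2)"
      using states_carrier[of u t] by (intro mat_diag_quadratic_form) auto
    also have "\<dots> = (\<Sum>i<p + 2. Qd i * (?x t $ i - (if i = e then \<sigma> t else 0))\<^sup>2)"
      using states_carrier[of u t] e
      by (intro sum.cong) (auto simp del: sum.lessThan_Suc)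
    finally have quad: "(?x t - target \<sigma> e t) \<bullet> (Q *\<^sub>v (?x t - target \<sigma> e t))
        = (\<Sum>i<p + 2. Qd i * (?x t $ i - (if i = e then \<sigma> t else 0))\<^sup>2)" .
    have Y: "?x (Suc t) $ i = (if i + 1 < p then ?x t $ (i + 1)
        else if i + 1 = p then ?x t $ 0 + u t $ 0 else u t $ (i + 1 - p))" if "i < p + 2" for i
      unfolding states.simps by (rule step_index[OF states_carrier spec[OF u] that])
    show ?thesis
      unfolding quad mat_diag_quadratic_form[OF spec[OF u]] excess_def
      by (rule bellman_step[where h = ?h and t = t and s = "\<sigma> t" and X = "\<lambda>i. ?x t $ i"
            and Y = "\<lambda>i. ?x (Suc t) $ i" and U = "\<lambda>j. u t $ j", OF e H_rec[OF \<sigma>] Y])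
  qed
  have "(\<Sum>t<N. (1/2) * ((?x t - target \<sigma> e t) \<bullet> (Q *\<^sub>v (?x t - target \<sigma> e t)) + u t \<bullet> (R *\<^sub>v u t)))
      + (\<Sum>t<N. ?V (Suc t) - ?V t)
    = (\<Sum>t<N. 1 / (2 * \<rho>) * (excess N \<sigma> e u t)\<^sup>2 + lo / 2 * (u t $ 1)\<^sup>2 + hi / 2 * (u t $ 2)\<^sup>2) + opt_cost N \<sigma> e"
    unfolding opt_cost_def sum.distrib[symmetric] by (intro sum.cong refl) (rule step)
  \<comment> \<open>The initial state is zero, and no target is pending at time \<open>N\<close>.
    What the telescoping sum leaves is exactly the DARE terminal cost.\<close>
  moreover have "(\<Sum>t<N. ?V (Suc t) - ?V t) = (1/2) * (?x N \<bullet> (P *\<^sub>v ?x N))"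
  proof -
    have "?V 0 = 0"
      unfolding V_def by (auto simp del: sum.lessThan_Suc intro!: sum.neutral)
    moreover have "(\<Sum>i<p. lin_coeff ?h e N i * ?x N $ i) = 0"
      using e by (intro sum.neutral) (auto simp: lin_coeff_def H_eq_0[OF \<sigma>])
    ultimately show ?thesis
      unfolding sum_lessThan_telescope[of ?V N] mat_diag_quadratic_form[OF states_carrier]
      by (simp add: V_def del: sum.lessThan_Suc)
  qed
  ultimately show ?thesis
    by (simp add: J_def lq_cost_def sum_distrib_left del: sum.lessThan_Suc)
qed

text \<open>It suffices to bound \<open>J_opt\<close> from above: the feedback law with zero excess
  and zero scalar inputs attains \<open>opt_cost\<close>.\<close>

lemma regret_ge:
  assumes \<sigma>: "\<forall>t\<ge>N. \<sigma> t = 0" and e: "e < p" and u: "\<forall>t. u t \<in> carrier_vec 3"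
  shows "J N A B Q R P (target \<sigma> e) u - J_opt N 3 A B Q R P (target \<sigma> e)
    \<ge> (\<Sum>t<N. 1 / (2 * \<rho>) * (excess N \<sigma> e u t)\<^sup>2)"
proof -
  let ?J = "J N A B Q R P (target \<sigma> e)"
  have ge: "(\<Sum>t<N. 1 / (2 * \<rho>) * (excess N \<sigma> e u t)\<^sup>2) + opt_cost N \<sigma> e \<le> ?J u"
    if "\<forall>t. u t \<in> carrier_vec 3" for u
    unfolding J_eq[OF \<sigma> e that] using lo_pos hi_pos
    by (intro add_right_mono sum_mono) (simp add: add_nonneg_nonneg)
  have nonneg: "0 \<le> (\<Sum>t<N. 1 / (2 * \<rho>) * (excess N \<sigma> e u t)\<^sup>2)" for u
    using \<rho> by (intro sum_nonneg) simp
  define fb where "fb t x = vec 3 (\<lambda>j. if j = 0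
      then \<rho> * x $ 0 + \<rho> * q * H N \<sigma> (t + p - e) - x $ 0 else 0)" for t and x :: "real vec"
  obtain u' where u': "\<forall>t. u' t = fb t (states A B u' t)"
    using feedback_realizable by blast
  have u'_carrier: "\<forall>t. u' t \<in> carrier_vec 3"
  proof
    show "u' t \<in> carrier_vec 3" for t using spec[OF u', of t] by (simp add: fb_def)
  qed
  have "u' t $ 0 = \<rho> * states A B u' t $ 0 + \<rho> * q * H N \<sigma> (t + p - e) - states A B u' t $ 0
      \<and> u' t $ 1 = 0 \<and> u' t $ 2 = 0" for t
    using arg_cong[OF spec[OF u', of t], of "\<lambda>v. v $ 0"] arg_cong[OF spec[OF u', of t], of "\<lambda>v. v $ 1"]
      arg_cong[OF spec[OF u', of t], of "\<lambda>v. v $ 2"] by (simp add: fb_def)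
  then have "?J u' = opt_cost N \<sigma> e"
    by (subst J_eq[OF \<sigma> e u'_carrier]) (auto simp: excess_def)
  then have "J_opt N 3 A B Q R P (target \<sigma> e) \<le> opt_cost N \<sigma> e"
    unfolding J_opt_def
  proof (intro cInf_lower2[of "?J u'"] bdd_belowI[of _ "opt_cost N \<sigma> e"])
    show "?J u' \<in> {?J u |u. \<forall>t. u t \<in> carrier_vec 3}" using u'_carrier by blast
    show "opt_cost N \<sigma> e \<le> y" if y: "y \<in> {?J u |u. \<forall>t. u t \<in> carrier_vec 3}" for y
    proof -
      obtain u where u: "\<forall>t. u t \<in> carrier_vec 3" and y_eq: "y = ?J u" using y by blast
      show ?thesis unfolding y_eq using ge[OF u] nonneg[of u] by linarith
    qed
  qed simp
  then show ?thesis using ge[OF u] by linarith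
qed

section \<open>Condition number\<close>

lemma block_of_index: "(LEAST i. r < k i) = (if r < p then 1 else r + 2 - p)"
  using p by (intro Least_equality) (auto simp: k_def split: if_splits)

lemma x_of_z_index:
  assumes "r < p + 2"
  shows "x_of_z (p + 2) 3 k z t $ r
    = (if r < p then z_comp 3 z (int t + int r + 1 - int p) 0 else z_comp 3 z (int t) (r + 1 - p))"
proof -
  have "x_of_z (p + 2) 3 k z t $ r = (let i = if r < p then 1 else r + 2 - p in
      z_comp 3 z (int t + int r + 1 - int (k i)) (i - 1))"
    using assms unfolding x_of_z_def block_of_index by simp
  moreover have "k 1 = p" "p \<le> r \<Longrightarrow> k (r + 2 - p) = r + 1" by (auto simp: k_def)
  ultimately show ?thesis by (auto simp: Let_def Suc_diff_le)
qed

lemma u_of_z_index: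
  assumes "j < 3"
  shows "u_of_z (p + 2) 3 k A z t $ j
    = z_comp 3 z (int t + 1) j - (if j = 0 then z_comp 3 z (int t + 1 - int p) 0 else 0)"
proof -
  have "k (Suc j) - 1 = p - 1 + j" using p by (simp add: k_def)
  then have "u_of_z (p + 2) 3 k A z t $ j
      = z_comp 3 z (int t + 1) j - row A (p - 1 + j) \<bullet> x_of_z (p + 2) 3 k z t"
    using assms by (simp add: u_of_z_def)
  also have "row A (p - 1 + j) \<bullet> x_of_z (p + 2) 3 k z t = (if j = 0 then x_of_z (p + 2) 3 k z t $ 0 else 0)"
    using assms p by (subst row_A) (auto simp: x_of_z_def)
  also have "x_of_z (p + 2) 3 k z t $ 0 = z_comp 3 z (int t + 1 - int p) 0"
    using p by (subst x_of_z_index) auto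
  finally show ?thesis .
qed

lemma u_of_z_carrier: "u_of_z (p + 2) 3 k A z t \<in> carrier_vec 3"
  by (simp add: u_of_z_def)

lemma x_of_z_carrier: "x_of_z (p + 2) 3 k z t \<in> carrier_vec (p + 2)"
  by (simp add: x_of_z_def)

text \<open>Each \<open>z\<close> describes a genuine trajectory. The zero initial state corresponds
  to \<open>z_comp\<close> being zero at nonpositive times.\<close>

lemma x_of_z_eq_states: "x_of_z (p + 2) 3 k z t = states A B (u_of_z (p + 2) 3 k A z) t"
proof (induction t)
  case 0
  show ?case
  proof (rule eq_vecI)
    fix i assume "i < dim_vec (states A B (u_of_z (p + 2) 3 k A z) 0)"
    then have i: "i < p + 2" by simp
    then show "x_of_z (p + 2) 3 k z 0 $ i = states A B (u_of_z (p + 2) 3 k A z) 0 $ i"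
      unfolding x_of_z_index[OF i] by (simp add: z_comp_def)
  qed (simp add: x_of_z_def)
next
  case (Suc t)
  show ?case
  proof (rule eq_vecI)
    fix i assume "i < dim_vec (states A B (u_of_z (p + 2) 3 k A z) (Suc t))"
    then have i: "i < p + 2" using carrier_vecD[OF states_carrier] by metis
    show "x_of_z (p + 2) 3 k z (Suc t) $ i = states A B (u_of_z (p + 2) 3 k A z) (Suc t) $ i"
      unfolding states.simps Suc.IH[symmetric] step_index[OF x_of_z_carrier u_of_z_carrier i]
    proof -
      have 0: "0 < p + 2" by simp
      consider "i + 1 < p" | "i + 1 = p" | "p \<le> i" "i + 1 - p < 3" using i by linarith
      then show "x_of_z (p + 2) 3 k z (Suc t) $ i = (if i + 1 < p then x_of_z (p + 2) 3 k z t $ (i + 1)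
          else if i + 1 = p then x_of_z (p + 2) 3 k z t $ 0 + u_of_z (p + 2) 3 k A z t $ 0
          else u_of_z (p + 2) 3 k A z t $ (i + 1 - p))"
      proof cases
        case 1
        then have "i + 1 < p + 2" by simp
        with 1 show ?thesis
          unfolding x_of_z_index[OF i] by (subst x_of_z_index) (simp_all add: algebra_simps)
      next
        case 2
        then have idx: "int (Suc t) + int i + 1 - int p = int t + 1" by simp
        from 2 p show ?thesis
          unfolding x_of_z_index[OF i] x_of_z_index[OF 0] idx by (subst u_of_z_index) simp_all
      next
        case 3
        then show ?thesis
          unfolding x_of_z_index[OF i] u_of_z_index[OF 3(2)] by (simp add: add.commute)
      qed
    qed
  qed (use carrier_vecD[OF states_carrier] carrier_vecD[OF x_of_z_carrier] in metis)
qed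

lemma C_cost_eq: "C_cost N (p + 2) 3 k A Q R P \<theta> z = J N A B Q R P \<theta> (u_of_z (p + 2) 3 k A z)"
  unfolding C_cost_def J_def lq_cost_def x_of_z_eq_states ..

text \<open>Row \<open>i\<close> of \<open>1 - \<rho> S\<close> on the stacked \<open>z\<close>:
  residue \<open>0\<close> modulo 3 is the chain, where \<open>3 * p\<close> positions back means
  \<open>p\<close> time steps earlier; the scalar blocks give plain coordinates.\<close>

definition L :: "nat \<Rightarrow> nat \<Rightarrow> real vec" where
  "L d i = unit_vec d i - (if i mod 3 = 0 \<and> 3 * p \<le> i then \<rho> \<cdot>\<^sub>v unit_vec d (i - 3 * p) else 0\<^sub>v d)"

definition w :: "nat \<Rightarrow> real" where
  "w i = (if i mod 3 = 0 then 1 / \<rho> else if i mod 3 = 1 then lo else hi)"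

lemma L_carrier: "L d i \<in> carrier_vec d"
  by (simp add: L_def)

lemma L_scalar_prod:
  assumes "i < d" "z \<in> carrier_vec d"
  shows "L d i \<bullet> z = z $ i - \<rho> * (if i mod 3 = 0 \<and> 3 * p \<le> i then z $ (i - 3 * p) else 0)"
proof -
  have "L d i \<bullet> z = unit_vec d i \<bullet> z
      - (if i mod 3 = 0 \<and> 3 * p \<le> i then \<rho> \<cdot>\<^sub>v unit_vec d (i - 3 * p) else 0\<^sub>v d) \<bullet> z"
    unfolding L_def using assms by (intro minus_scalar_prod_distrib[of _ d]) auto
  then show ?thesis using assms by auto
qed

lemma C_cost_sum_squares:
  assumes \<sigma>: "\<forall>t\<ge>N. \<sigma> t = 0" and e: "e < p" and z: "z \<in> carrier_vec (N * 3)"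
  shows "C_cost N (p + 2) 3 k A Q R P (target \<sigma> e) z = opt_cost N \<sigma> e
    + (1/2) * (\<Sum>i<N * 3. w i * (L (N * 3) i \<bullet> z
        - (if i mod 3 = 0 then \<rho> * q * H N \<sigma> (i div 3 + p - e) else 0))\<^sup>2)"
proof -
  let ?u = "u_of_z (p + 2) 3 k A z"
  let ?g = "\<lambda>i. w i * (L (N * 3) i \<bullet> z
        - (if i mod 3 = 0 then \<rho> * q * H N \<sigma> (i div 3 + p - e) else 0))\<^sup>2"
  have "1 / (2 * \<rho>) * (excess N \<sigma> e ?u t)\<^sup>2 + lo / 2 * (?u t $ 1)\<^sup>2 + hi / 2 * (?u t $ 2)\<^sup>2
      = (1/2) * (?g (t * 3) + ?g (t * 3 + 1) + ?g (t * 3 + 2))" if t: "t < N" for t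
  proof -
    have lt: "t * 3 < N * 3" "t * 3 + 1 < N * 3" "t * 3 + 2 < N * 3" using t by auto
    have x0: "states A B ?u t $ 0 = z_comp 3 z (int t + 1 - int p) 0"
      unfolding x_of_z_eq_states[symmetric] using p by (subst x_of_z_index) auto
    have nxt: "z_comp 3 z (int t + 1) j = z $ (t * 3 + j)" for j
      by (simp add: z_comp_def)
    \<comment> \<open>Position \<open>t * 3\<close> holds the chain value of time
      \<open>t + 1\<close>, so \<open>p \<le> t\<close> says that the earlier time
      \<open>t + 1 - p\<close> is positive.\<close>
    have past: "z_comp 3 z (int t + 1 - int p) 0 = (if 3 * p \<le> t * 3 then z $ (t * 3 - 3 * p) else 0)"
    proof (cases "p \<le> t")
      case True
      then have "nat (int t + 1 - int p - 1) * 3 + 0 = t * 3 - 3 * p" by (simp add: nat_diff_distrib')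
      then show ?thesis using True unfolding z_comp_def by simp
    next
      case False
      then show ?thesis by (simp add: z_comp_def)
    qed
    have "?u t $ 1 = z $ (t * 3 + 1)" "?u t $ 2 = z $ (t * 3 + 2)"
      "?u t $ 0 = z $ (t * 3) - z_comp 3 z (int t + 1 - int p) 0"
      by (subst u_of_z_index; simp add: nxt)+
    moreover have "?g (t * 3 + 1) = lo * (z $ (t * 3 + 1))\<^sup>2" "?g (t * 3 + 2) = hi * (z $ (t * 3 + 2))\<^sup>2"
      using L_scalar_prod[OF lt(2) z] L_scalar_prod[OF lt(3) z] by (simp_all add: w_def mod_Suc)
    moreover have "?g (t * 3) = 1 / \<rho> * (z $ (t * 3) - \<rho> * z_comp 3 z (int t + 1 - int p) 0
        - \<rho> * q * H N \<sigma> (t + p - e))\<^sup>2"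
      unfolding L_scalar_prod[OF lt(1) z] past by (simp add: w_def)
    ultimately show ?thesis
      unfolding excess_def x0 by (simp only:) (simp add: field_simps)
  qed
  then have "(\<Sum>t<N. 1 / (2 * \<rho>) * (excess N \<sigma> e ?u t)\<^sup>2 + lo / 2 * (?u t $ 1)\<^sup>2 + hi / 2 * (?u t $ 2)\<^sup>2)
      = (1/2) * (\<Sum>t<N. ?g (t * 3) + ?g (t * 3 + 1) + ?g (t * 3 + 2))"
    unfolding sum_distrib_left by (intro sum.cong) auto
  then show ?thesis
    unfolding C_cost_eq J_eq[OF \<sigma> e allI[OF u_of_z_carrier]] sum_lessThan_mult3[of ?g]
    by linarith
qed

text \<open>The chain contributes \<open>\<parallel>(1 - \<rho>S) x\<parallel>\<^sup>2 / \<rho>\<close> for a truncated shift \<open>S\<close> of norm at most 1.\<close>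

lemma w_L_bounds:
  assumes z: "z \<in> carrier_vec d"
  shows "lo * (z \<bullet> z) \<le> (\<Sum>i<d. w i * (L d i \<bullet> z)\<^sup>2) \<and> (\<Sum>i<d. w i * (L d i \<bullet> z)\<^sup>2) \<le> hi * (z \<bullet> z)"
proof -
  define x where "x i = (if i mod 3 = 0 then z $ i else 0)" for i
  define y where "y i = (if 3 * p \<le> i then x (i - 3 * p) else 0)" for i
  define D where "D = (\<Sum>i<d. (x i)\<^sup>2) - (\<Sum>i<d. (y i)\<^sup>2)"
  have "(\<Sum>i<d. (y i)\<^sup>2) = (\<Sum>i<d. if 3 * p \<le> i then (x (i - 3 * p))\<^sup>2 else 0)"
    by (intro sum.cong) (auto simp: y_def)
  then have D: "D \<ge> 0" using shift_norm_le[of "3 * p" x d] by (simp add: D_def)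
  have zz: "z \<bullet> z = (\<Sum>i<d. (z $ i)\<^sup>2)"
    using z by (simp add: scalar_prod_def power2_eq_square atLeast0LessThan)
  have "lo \<le> hi" using \<rho> by (auto simp: lo_def hi_def intro!: divide_right_mono power_mono)
  \<comment> \<open>The corrections make both gaps perfect squares, \<open>(a - b)^2\<close> and
    \<open>(a + b)^2\<close>, and sum to nonnegative multiples of \<open>D\<close>.\<close>
  have chain: "lo * a\<^sup>2 + (1 - \<rho>) * (a\<^sup>2 - b\<^sup>2) \<le> 1 / \<rho> * (a - \<rho> * b)\<^sup>2"
    "1 / \<rho> * (a - \<rho> * b)\<^sup>2 \<le> hi * a\<^sup>2 - (1 + \<rho>) * (a\<^sup>2 - b\<^sup>2)" for a b
  proof -
    have "1 / \<rho> * (a - \<rho> * b)\<^sup>2 - (lo * a\<^sup>2 + (1 - \<rho>) * (a\<^sup>2 - b\<^sup>2)) = (a - b)\<^sup>2"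
      using \<rho> by (simp add: lo_def field_simps power2_eq_square)
    then show "lo * a\<^sup>2 + (1 - \<rho>) * (a\<^sup>2 - b\<^sup>2) \<le> 1 / \<rho> * (a - \<rho> * b)\<^sup>2"
      using zero_le_power2[of "a - b"] by linarith
    have "hi * a\<^sup>2 - (1 + \<rho>) * (a\<^sup>2 - b\<^sup>2) - 1 / \<rho> * (a - \<rho> * b)\<^sup>2 = (a + b)\<^sup>2"
      using \<rho> by (simp add: hi_def field_simps power2_eq_square)
    then show "1 / \<rho> * (a - \<rho> * b)\<^sup>2 \<le> hi * a\<^sup>2 - (1 + \<rho>) * (a\<^sup>2 - b\<^sup>2)"
      using zero_le_power2[of "a + b"] by linarith
  qed
  have stage: "lo * (z $ i)\<^sup>2 + (1 - \<rho>) * ((x i)\<^sup>2 - (y i)\<^sup>2) \<le> w i * (L d i \<bullet> z)\<^sup>2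
      \<and> w i * (L d i \<bullet> z)\<^sup>2 \<le> hi * (z $ i)\<^sup>2 - (1 + \<rho>) * ((x i)\<^sup>2 - (y i)\<^sup>2)" if i: "i < d" for i
  proof -
    have m: "(i - 3 * p) mod 3 = i mod 3" if "3 * p \<le> i"
      using that by (auto simp: le_iff_add)
    show ?thesis
    proof (cases "i mod 3 = 0")
      case True
      then have "x i = z $ i" "L d i \<bullet> z = z $ i - \<rho> * y i"
        unfolding L_scalar_prod[OF i z] using m by (auto simp: x_def y_def)
      then show ?thesis using True chain[of "z $ i" "y i"] by (simp add: w_def)
    next
      case False
      then have "x i = 0" "y i = 0" "L d i \<bullet> z = z $ i"
        unfolding L_scalar_prod[OF i z] using m by (auto simp: x_def y_def)
      then show ?thesis using False \<open>lo \<le> hi\<close> by (auto simp: w_def intro!: mult_right_mono)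
    qed
  qed
  have "lo * (z \<bullet> z) + (1 - \<rho>) * D = (\<Sum>i<d. lo * (z $ i)\<^sup>2 + (1 - \<rho>) * ((x i)\<^sup>2 - (y i)\<^sup>2))"
    by (simp add: zz D_def sum.distrib sum_distrib_left sum_subtractf right_diff_distrib)
  also have "\<dots> \<le> (\<Sum>i<d. w i * (L d i \<bullet> z)\<^sup>2)"
    using stage by (intro sum_mono) auto
  finally have lower: "lo * (z \<bullet> z) + (1 - \<rho>) * D \<le> (\<Sum>i<d. w i * (L d i \<bullet> z)\<^sup>2)" .
  have "(\<Sum>i<d. w i * (L d i \<bullet> z)\<^sup>2) \<le> (\<Sum>i<d. hi * (z $ i)\<^sup>2 - (1 + \<rho>) * ((x i)\<^sup>2 - (y i)\<^sup>2))"
    using stage by (intro sum_mono) auto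
  also have "\<dots> = hi * (z \<bullet> z) - (1 + \<rho>) * D"
    by (simp add: zz D_def sum_distrib_left sum_subtractf right_diff_distrib)
  finally have upper: "(\<Sum>i<d. w i * (L d i \<bullet> z)\<^sup>2) \<le> hi * (z \<bullet> z) - (1 + \<rho>) * D" .
  have "0 \<le> (1 - \<rho>) * D" "0 \<le> (1 + \<rho>) * D" using D \<rho> by simp_all
  then show ?thesis using lower upper by linarith
qed

text \<open>Chain rows refer back only to indices divisible by 3, so coordinate \<open>s\<close>
  occurs in no linear form but its own, and the unit vector at \<open>s\<close> is an
  eigenvector.\<close>

lemma eigenvalue_decoupled:
  assumes s: "s < d" "s mod 3 \<noteq> 0"
  shows "eigenvalue (mat d d (\<lambda>(i, j). \<Sum>r<d. w r * L d r $ i * L d r $ j)) (w s)"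
proof -
  let ?M = "mat d d (\<lambda>(i, j). \<Sum>r<d. w r * L d r $ i * L d r $ j)"
  have L_s: "L d r $ s = (if r = s then 1 else 0)" if "r < d" for r
  proof -
    have "(r - 3 * p) mod 3 = 0" if "r mod 3 = 0" "3 * p \<le> r"
      using that by (auto simp: le_iff_add)
    then have "\<not> (r mod 3 = 0 \<and> 3 * p \<le> r \<and> s = r - 3 * p)" using s by auto
    then show ?thesis using s that by (auto simp: L_def)
  qed
  have "?M *\<^sub>v unit_vec d s = w s \<cdot>\<^sub>v unit_vec d s"
  proof (rule eq_vecI)
    fix i assume "i < dim_vec (w s \<cdot>\<^sub>v unit_vec d s)"
    then have i: "i < d" by simp
    have "(?M *\<^sub>v unit_vec d s) $ i = (\<Sum>r<d. w r * L d r $ i * L d r $ s)"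
      using i s by simp
    also have "\<dots> = (\<Sum>r<d. if r = s then w r * L d r $ i else 0)"
      using L_s by (intro sum.cong) auto
    also have "\<dots> = w s * L d s $ i" using s by simp
    also have "L d s $ i = unit_vec d s $ i" using s i by (simp add: L_def)
    finally show "(?M *\<^sub>v unit_vec d s) $ i = (w s \<cdot>\<^sub>v unit_vec d s) $ i" using i s by simp
  qed simp
  moreover have "unit_vec d s \<noteq> (0\<^sub>v d :: real vec)" using s by simp
  ultimately show ?thesis by (auto simp: eigenvalue_def eigenvector_def intro!: exI[of _ "unit_vec d s"])
qed

lemma condition_number_C:
  assumes \<sigma>: "\<forall>t\<ge>N. \<sigma> t = 0" and e: "e < p" and N: "N \<ge> 1"
  shows "condition_number (hessian (N * 3) (C_cost N (p + 2) 3 k A Q R P (target \<sigma> e)) (0\<^sub>v (N * 3))) = hi / lo"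
proof -
  let ?d = "N * 3"
  let ?M = "mat ?d ?d (\<lambda>(i, j). \<Sum>r<?d. w r * L ?d r $ i * L ?d r $ j)"
  have "hessian ?d (C_cost N (p + 2) 3 k A Q R P (target \<sigma> e)) (0\<^sub>v ?d) = ?M"
    by (rule hessian_sum_squares[OF L_carrier C_cost_sum_squares[OF \<sigma> e]])
  moreover have "condition_number ?M = hi / lo"
  proof (rule condition_number_eqI)
    show "?M \<in> carrier_mat ?d ?d" by simp
    show "eigenvalue ?M lo" using eigenvalue_decoupled[of 1 ?d] N by (simp add: w_def)
    show "eigenvalue ?M hi" using eigenvalue_decoupled[of 2 ?d] N by (simp add: w_def)
    show "lo * (v \<bullet> v) \<le> v \<bullet> (?M *\<^sub>v v) \<and> v \<bullet> (?M *\<^sub>v v) \<le> hi * (v \<bullet> v)" if "v \<in> carrier_vec ?d" for v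
      unfolding sum_squares_quadratic_form[OF L_carrier that] by (rule w_L_bounds[OF that])
  qed
  ultimately show ?thesis by simp
qed

section \<open>The adversary\<close>

text \<open>Since \<open>p \<ge> 1\<close>, time \<open>T\<close> occurs in the sum at the single
  index \<open>i = K\<close>.\<close>

lemma H_flip:
  assumes "K < N" "x + K * p = T"
  shows "H N \<sigma> x - H N (\<sigma>(T := - \<sigma> T)) x = \<rho> ^ K * (2 * \<sigma> T)"
proof -
  have "H N \<sigma> x - H N (\<sigma>(T := - \<sigma> T)) x
      = (\<Sum>i<N. \<rho> ^ i * (\<sigma> (x + i * p) - (\<sigma>(T := - \<sigma> T)) (x + i * p)))"
    by (simp add: H_def sum_subtractf right_diff_distrib)
  also have "\<dots> = (\<Sum>i<N. if i = K then \<rho> ^ K * (2 * \<sigma> T) else 0)"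
    using assms(2) p by (intro sum.cong) auto
  also have "\<dots> = \<rho> ^ K * (2 * \<sigma> T)" using assms(1) by simp
  finally show ?thesis .
qed

text \<open>
  Placing the target in component \<open>p - 1 - (W - 1) mod p\<close> delays its revelation so that the input
  at time \<open>t\<close> is chosen just before the target at time \<open>t + W\<close> is seen, while the optimal input
  depends on that target with weight proportional to \<open>\<rho> ^ ((W - 1) div p)\<close>.
\<close>

lemma adversary:
  assumes on: "online W alg" and W: "1 \<le> W" and WM: "W + M \<le> N"
  defines "e \<equiv> p - 1 - (W - 1) mod p" and "K \<equiv> (W - 1) div p"
  shows "\<exists>\<sigma>. (\<forall>t. \<bar>\<sigma> t\<bar> = (if t \<in> {W..<W + M} then \<bar>\<theta>\<bar> else 0)) \<and>
    regret N (p + 2) 3 A B Q R P (target \<sigma> e) alg \<ge> real M * (\<rho> * q\<^sup>2 * \<rho> ^ (2 * K) * \<theta>\<^sup>2 / 2)"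
proof -
  define b where "b = \<rho> * q\<^sup>2 * \<rho> ^ (2 * K) * \<theta>\<^sup>2 / 2"
  define S where "S = {\<sigma>. \<forall>t. (t \<in> {W..<W + M} \<longrightarrow> \<sigma> t \<in> {\<theta>, - \<theta>}) \<and> (t \<notin> {W..<W + M} \<longrightarrow> \<sigma> t = 0)}"
  define u where "u \<sigma> = alg_input 3 A B alg (f_stage N (p + 2) Q (target \<sigma> e)) (g_stage R)" for \<sigma>
  define F where "F t \<sigma> = 1 / (2 * \<rho>) * (excess N \<sigma> e (u \<sigma>) t)\<^sup>2" for t \<sigma>
  define \<phi> where "\<phi> t \<sigma> = \<sigma>(t + W := - \<sigma> (t + W))" for t and \<sigma> :: "nat \<Rightarrow> real"
  have e: "e < p" using p by (simp add: e_def)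
  have spike: "\<sigma> (t + W) \<in> {\<theta>, - \<theta>}" if "\<sigma> \<in> S" "t < M" for \<sigma> t
    using that unfolding S_def by (simp add: add.commute)
  have "\<exists>\<sigma>\<in>S. (\<Sum>t\<in>{..<M}. F t \<sigma>) \<ge> real (card {..<M}) * b"
  proof (rule exists_ge_average_of_involutions[where \<phi> = \<phi>])
    show "finite S" unfolding S_def by (rule finite_set_of_finite_funs) auto
    have "(\<lambda>t. if t \<in> {W..<W + M} then \<theta> else 0) \<in> S" by (auto simp: S_def)
    then show "S \<noteq> {}" by blast
    show "\<phi> t \<sigma> \<in> S \<and> \<phi> t (\<phi> t \<sigma>) = \<sigma>" if "t \<in> {..<M}" "\<sigma> \<in> S" for t \<sigma>
    proof -
      have "- \<sigma> (t + W) = \<theta> \<or> - \<sigma> (t + W) = - \<theta>"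
        using that spike[of \<sigma> t] by (cases "\<sigma> (t + W) = \<theta>") simp_all
      then show ?thesis using that by (auto simp: S_def \<phi>_def)
    qed
    show "2 * b \<le> F t \<sigma> + F t (\<phi> t \<sigma>)" if t: "t \<in> {..<M}" and \<sigma>: "\<sigma> \<in> S" for t \<sigma>
    proof -
      let ?a = "excess N \<sigma> e (u \<sigma>) t" and ?a' = "excess N (\<phi> t \<sigma>) e (u (\<phi> t \<sigma>)) t"
      \<comment> \<open>The flip changes only the stage cost at time \<open>t + W\<close>, the first
        one hidden from the algorithm at time \<open>t\<close>.\<close>
      have same: "u \<sigma> t = u (\<phi> t \<sigma>) t \<and> states A B (u \<sigma>) t = states A B (u (\<phi> t \<sigma>)) t"
        unfolding u_def by (rule alg_input_causal[OF on]) (auto simp: f_stage_def \<phi>_def)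
      have "(W - 1) mod p < p" using p by simp
      then have "p - e = 1 + (W - 1) mod p" unfolding e_def by linarith
      moreover have "(W - 1) div p * p + (W - 1) mod p = W - 1" by simp
      \<comment> \<open>\<open>p - e\<close> is \<open>1 + (W - 1) mod p\<close>, which completes
        \<open>K * p\<close> to \<open>W\<close>; the hidden target enters the excess with weight
        \<open>\<rho> ^ K\<close>.\<close>
      ultimately have index: "t + p - e + K * p = t + W"
        using e W unfolding K_def by linarith
      have "K \<le> W - 1" by (simp add: K_def)
      then have K: "K < N" using W WM by linarith
      have "?a' - ?a = \<rho> * q * (H N \<sigma> (t + p - e) - H N (\<phi> t \<sigma>) (t + p - e))"
        using same by (simp add: excess_def right_diff_distrib)
      also have "\<dots> = \<rho> * q * (\<rho> ^ K * (2 * \<sigma> (t + W)))"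
        unfolding \<phi>_def H_flip[OF K index] ..
      finally have diff: "(?a' - ?a)\<^sup>2 = 4 * (\<rho> * q * \<rho> ^ K)\<^sup>2 * (\<sigma> (t + W))\<^sup>2"
        by (simp add: power_mult_distrib mult_ac)
      have "(\<sigma> (t + W))\<^sup>2 = \<theta>\<^sup>2" using spike[OF \<sigma>, of t] t by auto
      \<comment> \<open>\<open>b\<close> is chosen so that the pair bound is
        \<open>(x - y)^2 / 2 \<le> x^2 + y^2\<close> for the two excesses.\<close>
      then have "2 * b = 1 / (2 * \<rho>) * ((?a' - ?a)\<^sup>2 / 2)"
        using \<rho> unfolding diff b_def by (simp add: power_mult_distrib power2_eq_square power_mult field_simps)
      also have "\<dots> \<le> 1 / (2 * \<rho>) * (?a\<^sup>2 + ?a'\<^sup>2)"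
      proof (rule mult_left_mono)
        show "(?a' - ?a)\<^sup>2 / 2 \<le> ?a\<^sup>2 + ?a'\<^sup>2"
          using zero_le_power2[of "?a' + ?a"] by (simp add: power2_eq_square algebra_simps)
      qed (use \<rho> in simp)
      finally show ?thesis by (simp add: F_def distrib_left)
    qed
  qed
  then obtain \<sigma> where \<sigma>: "\<sigma> \<in> S" and ge: "(\<Sum>t<M. F t \<sigma>) \<ge> real M * b" by auto
  have abs: "\<bar>\<sigma> t\<bar> = (if t \<in> {W..<W + M} then \<bar>\<theta>\<bar> else 0)" for t
    using \<sigma> by (auto simp: S_def)
  have "\<forall>t\<ge>N. \<sigma> t = 0" using abs WM by (metis abs_eq_0_iff atLeastLessThan_iff le_trans not_le)
  moreover have "\<forall>t. u \<sigma> t \<in> carrier_vec 3" by (simp add: u_def alg_input_carrier)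
  ultimately have "(\<Sum>t<N. F t \<sigma>) \<le> regret N (p + 2) 3 A B Q R P (target \<sigma> e) alg"
    unfolding regret_def F_def u_def using e by (intro regret_ge)
  moreover have "(\<Sum>t<M. F t \<sigma>) \<le> (\<Sum>t<N. F t \<sigma>)"
    using WM \<rho> by (intro sum_mono2) (auto simp: F_def)
  ultimately show ?thesis using ge abs unfolding b_def by (intro exI[of _ \<sigma>]) auto
qed

end

section \<open>Choice of constants and assembly of the instance\<close>

theorem theorem3:
  fixes \<zeta> \<theta>bar :: real and p :: nat
  assumes "\<zeta> > 1" and "p \<ge> 1" and "\<theta>bar > 0"
  shows "\<exists>c > 0. \<forall>(N::nat) (W::nat) (L::real).
    1 \<le> W \<and> 3 * W \<le> N \<and> 4 * \<theta>bar \<le> L \<and> L \<le> (2 * real N + 1) * \<theta>bar \<longrightarrow>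
    (\<forall>alg. online W alg \<longrightarrow>
      (\<exists>n m A B k Q R P \<theta>.
         canonical_form n m A B k p \<and>
         posdef n Q \<and> posdef m R \<and> dare_solution n m A B Q R P \<and>
         (\<forall>t<N. \<theta> t \<in> carrier_vec n \<and> vnorm (\<theta> t) \<le> \<theta>bar) \<and>
         path_length N n \<theta> \<le> L \<and>
         condition_number (hessian (N * m) (C_cost N n m k A Q R P \<theta>) (0\<^sub>v (N * m))) = \<zeta> \<and>
         (let K = (W - 1) div p; \<rho> = (sqrt \<zeta> - 1) / (sqrt \<zeta> + 1) in
           regret N n m A B Q R P \<theta> alg \<ge> c * \<rho> ^ (2 * K) * L \<and>
           c * \<rho> ^ (2 * K) * L \<ge> c * \<rho> ^ (2 * K) * path_length N n \<theta>)))"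
proof -
  define s where "s = sqrt \<zeta>"
  \<comment> \<open>With this value \<open>(1 + \<rho>) / (1 - \<rho>)\<close> is
    \<open>sqrt \<zeta>\<close>, so the ratio of \<open>hi\<close> to \<open>lo\<close> is
    \<open>\<zeta>\<close>.\<close>
  define \<rho> where "\<rho> = (sqrt \<zeta> - 1) / (sqrt \<zeta> + 1)"
  have s: "s > 1" "s\<^sup>2 = \<zeta>" and \<rho>_eq: "\<rho> = (s - 1) / (s + 1)"
    using assms(1) by (simp_all add: s_def \<rho>_def)
  interpret cyclic_shift p \<rho>
    using s(1) assms(2) by unfold_locales (simp_all add: \<rho>_eq)
  have "hi / lo = ((1 + \<rho>) / (1 - \<rho>))\<^sup>2"
    using \<rho> by (simp add: hi_def lo_def power_divide)
  also have "(1 + \<rho>) / (1 - \<rho>) = s"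
    using s(1) by (simp add: \<rho>_eq field_simps)
  finally have ratio: "hi / lo = \<zeta>" using s(2) by simp
  \<comment> \<open>The regret per spike,
    \<open>\<rho> * q\<^sup>2 * \<theta>bar\<^sup>2 / 2\<close> up to the factor
    \<open>\<rho> ^ (2 * K)\<close>, times the guaranteed number
    \<open>L / (8 * \<theta>bar)\<close> of spikes, per unit of \<open>L\<close>. Only
    \<open>\<zeta>\<close>, \<open>p\<close> and \<open>\<theta>bar\<close> enter.\<close>
  define c where "c = \<rho> * q\<^sup>2 * \<theta>bar / 16"
  have c: "c > 0" using \<rho> q_pos assms(3) by (simp add: c_def)
  show ?thesis
  proof (intro exI[of _ c] conjI c allI impI, elim conjE)
    fix N W :: nat and L :: real and alg
    assume W: "1 \<le> W" "3 * W \<le> N" and L: "4 * \<theta>bar \<le> L" "L \<le> (2 * real N + 1) * \<theta>bar"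
      and on: "online W alg"
    \<comment> \<open>The divisor 4 keeps all spikes inside the horizon and the path length
      \<open>2 * M * \<theta>bar\<close> below \<open>L\<close>. As the quotient is at least 1,
      rounding down loses at most a factor 2.\<close>
    define M where "M = nat \<lfloor>L / (4 * \<theta>bar)\<rfloor>"
    define e where "e = p - 1 - (W - 1) mod p"
    let ?K = "(W - 1) div p"
    have "1 \<le> L / (4 * \<theta>bar)" using L assms(3) by (simp add: field_simps)
    then have "1 \<le> \<lfloor>L / (4 * \<theta>bar)\<rfloor>" by simp
    moreover from this have "real M = of_int \<lfloor>L / (4 * \<theta>bar)\<rfloor>" by (simp add: M_def)
    moreover have "L / (8 * \<theta>bar) = L / (4 * \<theta>bar) / 2" by simp
    ultimately have M: "real M \<le> L / (4 * \<theta>bar)" "L / (8 * \<theta>bar) \<le> real M"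
      by linarith+
    have "L / (4 * \<theta>bar) \<le> (2 * real N + 1) / 4"
      using L assms(3) by (simp add: field_simps)
    then have "real (4 * M) \<le> real (2 * N + 1)" using M(1) by simp
    then have "4 * M \<le> 2 * N + 1" by (simp only: of_nat_le_iff)
    \<comment> \<open>\<open>W\<close> takes at most a third of \<open>N\<close> and
      \<open>M\<close> at most \<open>(2 * N + 1) / 4\<close>; these fit because
      \<open>N \<ge> 3\<close>.\<close>
    then have WM: "W + M \<le> N" using W by linarith
    have abs_bound: "\<bar>\<theta>bar\<bar> = \<theta>bar" using assms(3) by simp
    obtain \<sigma> where \<sigma>_all: "\<forall>t. \<bar>\<sigma> t\<bar> = (if t \<in> {W..<W + M} then \<theta>bar else 0)"
      and reg: "regret N (p + 2) 3 A B Q R P (target \<sigma> e) alg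
        \<ge> real M * (\<rho> * q\<^sup>2 * \<rho> ^ (2 * ?K) * \<theta>bar\<^sup>2 / 2)"
      using adversary[OF on W(1) WM, of \<theta>bar, folded e_def, unfolded abs_bound] by (elim exE conjE)
    note \<sigma> = \<sigma>_all[rule_format]
    have e: "e < p" "e < p + 2" using p by (simp_all add: e_def)
    have \<sigma>0: "\<forall>t\<ge>N. \<sigma> t = 0"
      using \<sigma> WM by (metis abs_eq_0_iff atLeastLessThan_iff le_trans not_le)
    have "path_length N (p + 2) (target \<sigma> e) \<le> 2 * real M * \<theta>bar"
      using path_length_spikes[OF \<sigma> _ WM e(2)] assms(3) by simp
    also have "\<dots> \<le> L" using M(1) L assms(3) by (simp add: field_simps)
    finally have path: "path_length N (p + 2) (target \<sigma> e) \<le> L" .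
    have "c * \<rho> ^ (2 * ?K) * L = L / (8 * \<theta>bar) * (\<rho> * q\<^sup>2 * \<rho> ^ (2 * ?K) * \<theta>bar\<^sup>2 / 2)"
      using assms(3) by (simp add: c_def field_simps power2_eq_square)
    also have "\<dots> \<le> real M * (\<rho> * q\<^sup>2 * \<rho> ^ (2 * ?K) * \<theta>bar\<^sup>2 / 2)"
      using M(2) \<rho> by (intro mult_right_mono) auto
    finally have reg': "c * \<rho> ^ (2 * ?K) * L \<le> regret N (p + 2) 3 A B Q R P (target \<sigma> e) alg"
      using reg by linarith
    have path': "c * \<rho> ^ (2 * ?K) * path_length N (p + 2) (target \<sigma> e) \<le> c * \<rho> ^ (2 * ?K) * L"
      using path c \<rho> by (intro mult_left_mono) auto
    have bounded: "target \<sigma> e t \<in> carrier_vec (p + 2) \<and> vnorm (target \<sigma> e t) \<le> \<theta>bar" for t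
      using \<sigma>[of t] assms(3) e(2) by (simp add: vnorm_smult_unit_vec)
    have cond: "condition_number (hessian (N * 3) (C_cost N (p + 2) 3 k A Q R P (target \<sigma> e)) (0\<^sub>v (N * 3))) = \<zeta>"
      using condition_number_C[OF \<sigma>0 e(1)] W ratio by simp
    show "\<exists>n m A B k Q R P \<theta>.
         canonical_form n m A B k p \<and>
         posdef n Q \<and> posdef m R \<and> dare_solution n m A B Q R P \<and>
         (\<forall>t<N. \<theta> t \<in> carrier_vec n \<and> vnorm (\<theta> t) \<le> \<theta>bar) \<and>
         path_length N n \<theta> \<le> L \<and>
         condition_number (hessian (N * m) (C_cost N n m k A Q R P \<theta>) (0\<^sub>v (N * m))) = \<zeta> \<and>
         (let K = (W - 1) div p; \<rho> = (sqrt \<zeta> - 1) / (sqrt \<zeta> + 1) in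
           regret N n m A B Q R P \<theta> alg \<ge> c * \<rho> ^ (2 * K) * L \<and>
           c * \<rho> ^ (2 * K) * L \<ge> c * \<rho> ^ (2 * K) * path_length N n \<theta>)"
      unfolding Let_def \<rho>_def[symmetric]
      by (rule exI[of _ "p + 2"], rule exI[of _ 3], rule exI[of _ A], rule exI[of _ B], rule exI[of _ k],
          rule exI[of _ Q], rule exI[of _ R], rule exI[of _ P], rule exI[of _ "target \<sigma> e"])
        (intro conjI allI impI canonical posdef_Q posdef_R dare path cond reg' path'
          bounded[THEN conjunct1] bounded[THEN conjunct2])
  qed
qed

end
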